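(* (Bowen's formula) Let $(\Lambda,f)$ be a $C^1$ conformal repeller. Then the Hausdorff dimension of $\Lambda$ coincides with its upper and lower box dimensions and is given as the unique zero of the pressure function $$s\mapsto P(s,\Lambda,f)=\liminf_{n\to\infty}\frac1n\log\ \sup_{y\in\Lambda}\ \sum_{x\in\Lambda:\,f^n(x)=y}\bigl(Df^{(n)}_x\bigr)^{-s}.$$
   Context: $(\Lambda,d)$ is a non-empty compact metric space without isolated points and $f:\Lambda\to\Lambda$ is a continuous surjective map. $f$ is $C^1$ conformal at $x\in\Lambda$ if the double limit $Df_x=\lim_{u\neq v\to x}\frac{d(f(u),f(v))}{d(u,v)}$ (over $u,v\in\Lambda$, $u\ne v$, both tending to $x$) exists; it is $C^1$ conformal on $\Lambda$ if this holds at every point. $Df^{(n)}_x=Df_{f^{n-1}(x)}\cdots Df_{f(x)}Df_x$ is the conformal derivative of the $n$-th iterate. $(\Lambda,f)$ is a *$C^1$ conformal repeller* if: (C1) $f$ is $C^1$ conformal on $\Lambda$; (C2) $f$ is uniformly expanding: there are constants $C>0$, $\beta>1$ with $Df^{(n)}_x\ge C\beta^n$ for all $x\in\Lambda$ and $n\in\mathbb N$; (C3) $f$ is an open mapping. *)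

theory Defs
  imports "HOL-Analysis.Analysis"
begin

definition eln :: "ennreal \<Rightarrow> ereal" where
  "eln a = (if a = 0 then - \<infinity> else if a = \<infinity> then \<infinity> else ereal (ln (enn2real a)))"

text \<open>
  The \<open>s\<close>-th power of the diameter, with the usual conventions that the empty set
  contributes \<open>0\<close> and that a nonempty set contributes \<open>1\<close> when \<open>s = 0\<close>.  (The plain
  term \<open>diameter U powr s\<close> would give \<open>0\<close> for a singleton and \<open>s = 0\<close>.)
\<close>
definition diam_pow :: "real \<Rightarrow> 'a::metric_space set \<Rightarrow> ennreal" where
  "diam_pow s U = (if U = {} then 0 else if s = 0 then 1 else ennreal (diameter U powr s))"

text \<open>
  Boundedness of the covering sets is required explicitly, because \<open>diameter\<close> has no
  meaningful value on unbounded sets.  Finite covers are included by padding with empty sets.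
\<close>
definition hausdorff_premeasure :: "real \<Rightarrow> real \<Rightarrow> 'a::metric_space set \<Rightarrow> ennreal" where
  "hausdorff_premeasure s \<delta> A =
     (INF U\<in>{U :: nat \<Rightarrow> 'a set. (\<forall>i. bounded (U i) \<and> diameter (U i) \<le> \<delta>) \<and> A \<subseteq> (\<Union>i. U i)}.
        \<Sum>i. diam_pow s (U i))"

definition hausdorff_outer_measure :: "real \<Rightarrow> 'a::metric_space set \<Rightarrow> ennreal" where
  "hausdorff_outer_measure s A = (SUP \<delta>\<in>{0<..}. hausdorff_premeasure s \<delta> A)"

definition hausdorff_dim :: "'a::metric_space set \<Rightarrow> ereal" where
  "hausdorff_dim A = (INF s\<in>{s :: real. s \<ge> 0 \<and> hausdorff_outer_measure s A = 0}. ereal s)"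

text \<open>The minimal number of open \<open>\<delta>\<close>-balls centred in \<open>A\<close> that cover \<open>A\<close>
  (\<open>\<infinity>\<close> if finitely many do not suffice).\<close>
definition covering_number :: "real \<Rightarrow> 'a::metric_space set \<Rightarrow> ennreal" where
  "covering_number \<delta> A =
     (INF F\<in>{F. finite F \<and> F \<subseteq> A \<and> A \<subseteq> (\<Union>x\<in>F. ball x \<delta>)}. of_nat (card F))"

definition lower_box_dim :: "'a::metric_space set \<Rightarrow> ereal" where
  "lower_box_dim A =
     Liminf (at_right 0) (\<lambda>\<delta>. eln (covering_number \<delta> A) / ereal (- ln \<delta>))"

definition upper_box_dim :: "'a::metric_space set \<Rightarrow> ereal" where
  "upper_box_dim A =
     Limsup (at_right 0) (\<lambda>\<delta>. eln (covering_number \<delta> A) / ereal (- ln \<delta>))"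

text \<open>
  The metric space is a subset \<open>\<Lambda>\<close> of a type of class \<open>metric_space\<close>, and only the values
  of \<open>f\<close> on \<open>\<Lambda>\<close> matter.  The double limit is taken along pairs of distinct points
  of \<open>\<Lambda>\<close>; one of the two points may be \<open>x\<close> itself.
\<close>
definition conformal_filter :: "'a::metric_space set \<Rightarrow> 'a \<Rightarrow> ('a \<times> 'a) filter" where
  "conformal_filter \<Lambda> x = at (x, x) within {(u, v). u \<in> \<Lambda> \<and> v \<in> \<Lambda> \<and> u \<noteq> v}"

definition C1_conformal_at ::
    "'a::metric_space set \<Rightarrow> ('a \<Rightarrow> 'a) \<Rightarrow> 'a \<Rightarrow> bool" where
  "C1_conformal_at \<Lambda> f x \<longleftrightarrow>
     (\<exists>D :: real. ((\<lambda>(u, v). dist (f u) (f v) / dist u v) \<longlongrightarrow> D) (conformal_filter \<Lambda> x))"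

definition conformal_deriv :: "'a::metric_space set \<Rightarrow> ('a \<Rightarrow> 'a) \<Rightarrow> 'a \<Rightarrow> real" where
  "conformal_deriv \<Lambda> f x =
     Lim (conformal_filter \<Lambda> x) (\<lambda>(u, v). dist (f u) (f v) / dist u v)"

definition conformal_deriv_iter ::
    "'a::metric_space set \<Rightarrow> ('a \<Rightarrow> 'a) \<Rightarrow> nat \<Rightarrow> 'a \<Rightarrow> real" where
  "conformal_deriv_iter \<Lambda> f n x = (\<Prod>k<n. conformal_deriv \<Lambda> f ((f ^^ k) x))"

definition uniformly_expanding :: "'a::metric_space set \<Rightarrow> ('a \<Rightarrow> 'a) \<Rightarrow> bool" where
  "uniformly_expanding \<Lambda> f \<longleftrightarrow>
     (\<exists>C > 0. \<exists>\<beta> > 1. \<forall>x\<in>\<Lambda>. \<forall>n. conformal_deriv_iter \<Lambda> f n x \<ge> C * \<beta> ^ n)"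

definition C1_conformal_repeller :: "'a::metric_space set \<Rightarrow> ('a \<Rightarrow> 'a) \<Rightarrow> bool" where
  "C1_conformal_repeller \<Lambda> f \<longleftrightarrow>
     (\<forall>x\<in>\<Lambda>. C1_conformal_at \<Lambda> f x) \<and>
     uniformly_expanding \<Lambda> f \<and>
     open_map (top_of_set \<Lambda>) (top_of_set \<Lambda>) f"

text \<open>
  Sum, supremum and logarithm take extended values, so nothing depends on the preimage sets
  being finite.  The degenerate term at \<open>n = 0\<close> does not affect the limit inferior.
\<close>
definition pressure :: "real \<Rightarrow> 'a::metric_space set \<Rightarrow> ('a \<Rightarrow> 'a) \<Rightarrow> ereal" where
  "pressure s \<Lambda> f =
     liminf (\<lambda>n. ereal (1 / real n) *
       eln (SUP y\<in>\<Lambda>. \<Sum>\<^sub>\<infinity>x\<in>{x\<in>\<Lambda>. (f ^^ n) x = y}.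
              ennreal (conformal_deriv_iter \<Lambda> f n x powr (- s))))"

end

theory Submission
  imports Defs
begin

text \<open>
  Write \<open>D\<^sub>n\<close> for the conformal derivative of \<open>f\<^sup>n\<close>, let \<open>A\<^sub>n(s)\<close> be the supremum over
  \<open>y\<close> of the sum of \<open>D\<^sub>n(x) powr (- s)\<close> over the fibre \<open>f\<^sup>n(x) = y\<close>, and let \<open>P(s)\<close> be the
  lower exponential growth rate of \<open>A\<^sub>n(s)\<close>, that is, the pressure.

  The lower bound \<open>D\<^sub>n \<ge> C * \<beta>\<^sup>n\<close> makes \<open>P\<close> decrease at rate at least \<open>ln \<beta>\<close>, an upper bound for
  the derivative makes \<open>P\<close> Lipschitz, and \<open>P(0) \<ge> 0\<close> because fibres are nonempty.  So \<open>P\<close> has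
  exactly one zero \<open>s\<close>, and \<open>s \<ge> 0\<close>.  Since the Hausdorff dimension never exceeds the lower box
  dimension, two inequalities remain: the Hausdorff dimension is at least \<open>s\<close>, and the upper box
  dimension is at most \<open>s\<close>.  Both are obtained by comparing covers of \<open>\<Lambda>\<close> directly with the
  numbers \<open>A\<^sub>n\<close>, without constructing a conformal or Gibbs measure.

  Differentiability of class \<open>C\<^sup>1\<close> gives no bounded distortion.  By compactness it does give,
  for every \<open>\<epsilon> > 0\<close>, a scale below which one application of \<open>f\<close> is a similarity up to a factor
  \<open>exp (\<plusminus> \<epsilon>)\<close>, so that along orbits which stay close together \<open>f\<^sup>n\<close> is a similarity up to
  \<open>exp (O(\<epsilon> n))\<close>.  This loss is harmless: each bound is proved only for exponents different from
  \<open>s\<close>, and there an exponential gain in \<open>n\<close> absorbs it.  One-step expansion is arranged by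
  passing to an iterate \<open>f\<^sup>q\<close>, whose numbers \<open>A\<^sub>n\<close> are the \<open>A\<^bsub>q n\<^esub>\<close> of \<open>f\<close>.

  Lower bound (\<open>fibre_sup_bounded_of_covers\<close>).  Suppose \<open>\<Lambda>\<close> is covered by finitely many small balls of
  radii \<open>\<rho>\<^sub>i\<close> with the sum of \<open>\<rho>\<^sub>i powr t\<close> small, and let \<open>s' > t\<close>.  Iterate each ball until its image
  has a fixed size, after \<open>n\<^sub>i\<close> steps.  Then \<open>f\<^sup>n\<close> with \<open>n = n\<^sub>i\<close> is injective on the ball and the
  weight \<open>D\<^sub>n powr (- s')\<close> is at most \<open>K * \<rho>\<^sub>i powr t\<close> there.  Distributing a fibre of \<open>f\<^sup>N\<close> among the
  balls gives \<open>A\<^sub>N \<le> (\<Sum>i. K * \<rho>\<^sub>i powr t * A\<^bsub>N - n\<^sub>i\<^esub>)\<close>, whence \<open>A\<^sub>N(s')\<close> is bounded in \<open>N\<close> and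
  \<open>P(s') \<le> 0\<close>.  So if \<open>\<Lambda>\<close> is a null set for exponent \<open>t\<close>, then \<open>P \<le> 0\<close> beyond \<open>t\<close>, that is,
  \<open>t \<ge> s\<close>.

  Upper bound (\<open>cover_refinement\<close>, \<open>covering_growth\<close>).  If \<open>P(t) < 0\<close>, some \<open>A\<^sub>q(t)\<close> is below \<open>1\<close>.
  Because \<open>f\<close> is open, the points that follow the orbit of some \<open>x\<close> in the \<open>n\<close>-fold fibre of a
  finite net fill up \<open>\<Lambda>\<close>, and \<open>f\<^sup>n\<close> expands distances among the followers of \<open>x\<close> by at
  least a factor \<open>c\<^sub>x\<close>, namely \<open>D\<^sub>n(x)\<close> diminished by the distortion.  Pulling back covers bounds the covering numbers by
  \<open>N(\<delta>) \<le> (\<Sum>x. N(c\<^sub>x * \<delta>))\<close>, where the sum of \<open>c\<^sub>x powr (- t)\<close> is at most \<open>1\<close> for large \<open>n\<close>.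
  Induction over the scale yields \<open>N(\<delta>) = O(\<delta> powr (- t))\<close>.
\<close>

section \<open>Covers and dimensions of metric spaces\<close>

text \<open>
  Arbitrary covering sets are used instead of balls: they may be cut down and pulled back along \<open>f\<close>
  without any bookkeeping for centres.
\<close>
definition has_cover :: "'a::metric_space set \<Rightarrow> real \<Rightarrow> nat \<Rightarrow> bool" where
  "has_cover A \<delta> k \<longleftrightarrow> (\<exists>\<U>. finite \<U> \<and> card \<U> \<le> k \<and> A \<subseteq> \<Union>\<U> \<and>
     (\<forall>U\<in>\<U>. \<forall>u\<in>U. \<forall>v\<in>U. dist u v \<le> \<delta>))"

lemma has_coverI:
  assumes "finite \<U>" "card \<U> \<le> k" "A \<subseteq> \<Union>\<U>"
    and "\<And>U u v. U \<in> \<U> \<Longrightarrow> u \<in> U \<Longrightarrow> v \<in> U \<Longrightarrow> dist u v \<le> \<delta>"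
  shows "has_cover A \<delta> k"
  unfolding has_cover_def by (intro exI[of _ \<U>] conjI ballI assms)

lemma has_coverE:
  assumes "has_cover A \<delta> k"
  obtains \<U> where "finite \<U>" "card \<U> \<le> k" "A \<subseteq> \<Union>\<U>"
    "\<And>U u v. U \<in> \<U> \<Longrightarrow> u \<in> U \<Longrightarrow> v \<in> U \<Longrightarrow> dist u v \<le> \<delta>"
  using assms unfolding has_cover_def by blast

lemma has_cover_mono:
  assumes "has_cover A \<delta> k" "\<delta> \<le> \<delta>'" "k \<le> k'"
  shows "has_cover A \<delta>' k'"
  using assms(1)
proof (rule has_coverE)
  fix \<U> assume \<U>: "finite \<U>" "card \<U> \<le> k" "A \<subseteq> \<Union>\<U>"
    "\<And>U u v. U \<in> \<U> \<Longrightarrow> u \<in> U \<Longrightarrow> v \<in> U \<Longrightarrow> dist u v \<le> \<delta>"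
  have "dist u v \<le> \<delta>'" if "U \<in> \<U>" "u \<in> U" "v \<in> U" for U u v
    using \<U>(4)[OF that] assms(2) by simp
  then show ?thesis
    using assms(3) \<U>(1-3) by (intro has_coverI[of \<U>]) auto
qed

lemma eln_mono:
  assumes "a \<le> b" shows "eln a \<le> eln b"
proof (cases "a = 0 \<or> b = \<infinity>")
  case True
  then show ?thesis using assms by (auto simp: eln_def)
next
  case False
  then obtain x y where "a = ennreal x" "b = ennreal y" "0 < x" "x \<le> y"
    using assms by (cases a; cases b) (auto simp: top_unique ennreal_eq_0_iff not_le)
  then show ?thesis by (simp add: eln_def)
qed

lemma eln_ennreal: "c > 0 \<Longrightarrow> eln (ennreal c) = ereal (ln c)"
  by (simp add: eln_def)

lemma less_exp_of_eln_less:
  assumes "eln a < ereal c" shows "a < ennreal (exp c)"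
proof (rule ccontr)
  assume "\<not> a < ennreal (exp c)"
  then have "eln (ennreal (exp c)) \<le> eln a" by (intro eln_mono) simp
  with assms show False by (simp add: eln_ennreal)
qed

lemma diameter_ball_le_metric:
  fixes x :: "'a::metric_space"
  assumes "r > 0" shows "diameter (ball x r) \<le> 2 * r"
proof -
  have "dist u v \<le> 2 * r" if "u \<in> ball x r" "v \<in> ball x r" for u v
    using that dist_triangle3[of u v x] by simp
  then show ?thesis using assms unfolding diameter_def by (auto intro!: cSUP_least)
qed

lemma covering_number_ge_1: "A \<noteq> {} \<Longrightarrow> covering_number \<delta> A \<ge> 1"
  unfolding covering_number_def
proof (rule INF_greatest)
  fix F assume "A \<noteq> {}" "F \<in> {F. finite F \<and> F \<subseteq> A \<and> A \<subseteq> (\<Union>x\<in>F. ball x \<delta>)}"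
  then have "finite F" "F \<noteq> {}" by auto
  then have "1 \<le> card F" by (simp add: Suc_le_eq card_gt_0_iff)
  then have "of_nat 1 \<le> (of_nat (card F) :: ennreal)" by (rule of_nat_mono)
  then show "1 \<le> (of_nat (card F) :: ennreal)" by simp
qed

text \<open>
  A set of diameter at most \<open>\<delta> / 2\<close> that meets \<open>A\<close> lies in the open \<open>\<delta>\<close>-ball about any
  of its points in \<open>A\<close>.
\<close>
lemma covering_number_le:
  assumes "has_cover A (\<delta> / 2) k" "\<delta> > 0"
  shows "covering_number \<delta> A \<le> of_nat k"
  using assms(1)
proof (rule has_coverE)
  fix \<U> assume \<U>: "finite \<U>" "card \<U> \<le> k" "A \<subseteq> \<Union>\<U>"
    "\<And>U u v. U \<in> \<U> \<Longrightarrow> u \<in> U \<Longrightarrow> v \<in> U \<Longrightarrow> dist u v \<le> \<delta> / 2"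
  define c where "c U = (SOME x. x \<in> U \<inter> A)" for U
  define \<V> where "\<V> = {U \<in> \<U>. U \<inter> A \<noteq> {}}"
  have c: "c U \<in> U \<inter> A" if "U \<in> \<V>" for U
    using that unfolding c_def \<V>_def by (simp add: some_in_eq del: Int_iff)
  have fin: "finite \<V>" using \<U>(1) by (simp add: \<V>_def)
  have "A \<subseteq> (\<Union>x\<in>c ` \<V>. ball x \<delta>)"
  proof
    fix a assume a: "a \<in> A"
    then obtain U where U: "U \<in> \<U>" "a \<in> U" using \<U>(3) by blast
    then have "U \<in> \<V>" using a by (auto simp: \<V>_def)
    then have "dist (c U) a \<le> \<delta> / 2" using \<U>(4)[OF U(1) _ U(2)] c by blast
    then show "a \<in> (\<Union>x\<in>c ` \<V>. ball x \<delta>)" using \<open>U \<in> \<V>\<close> assms(2) by force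
  qed
  then have "covering_number \<delta> A \<le> of_nat (card (c ` \<V>))"
    unfolding covering_number_def using fin c by (intro INF_lower) auto
  also have "card (c ` \<V>) \<le> k"
    using card_image_le[OF fin, of c] card_mono[OF \<U>(1), of \<V>] \<U>(2) by (auto simp: \<V>_def)
  then have "(of_nat (card (c ` \<V>)) :: ennreal) \<le> of_nat k" by (rule of_nat_mono)
  finally show ?thesis .
qed

text \<open>
  The constant \<open>C\<close> contributes the term \<open>ln C / (- ln \<delta>)\<close>, up to the change of scale from
  \<open>\<delta>\<close> to \<open>\<delta> / 2\<close>, and this term tends to \<open>0\<close>.
\<close>
lemma upper_box_dim_le:
  assumes "C > 0"
    and cover: "\<And>\<delta>. 0 < \<delta> \<Longrightarrow> \<delta> < 1 \<Longrightarrow> \<exists>k. real k \<le> C * \<delta> powr (- t) \<and> has_cover A \<delta> k"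
  shows "upper_box_dim A \<le> ereal t"
proof -
  define E where "E = C * 2 powr t"
  have E: "E > 0" using assms(1) by (simp add: E_def)
  have bound: "eln (covering_number \<delta> A) / ereal (- ln \<delta>) \<le> ereal (ln E / (- ln \<delta>) + t)"
    if \<delta>: "0 < \<delta>" "\<delta> < 1" for \<delta>
  proof -
    obtain k where k: "real k \<le> C * (\<delta> / 2) powr (- t)" "has_cover A (\<delta> / 2) k"
      using cover[of "\<delta> / 2"] \<delta> by auto
    have "covering_number \<delta> A \<le> of_nat k" using covering_number_le[OF k(2)] \<delta> by simp
    also have "\<dots> = ennreal (real k)" by (simp add: ennreal_of_nat_eq_real_of_nat)
    also have "\<dots> \<le> ennreal (C * (\<delta> / 2) powr (- t))" using k(1) by (rule ennreal_leI)
    also have "C * (\<delta> / 2) powr (- t) = E * \<delta> powr (- t)"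
      using \<delta> by (simp add: E_def powr_divide powr_minus field_simps)
    finally have "eln (covering_number \<delta> A) \<le> eln (ennreal (E * \<delta> powr (- t)))" by (rule eln_mono)
    also have "\<dots> = ereal (ln E - t * ln \<delta>)" using E \<delta> by (simp add: eln_ennreal ln_mult ln_powr)
    finally have "eln (covering_number \<delta> A) / ereal (- ln \<delta>) \<le> ereal (ln E - t * ln \<delta>) / ereal (- ln \<delta>)"
      using \<delta> by (intro ereal_divide_right_mono) auto
    also have "\<dots> = ereal (ln E / (- ln \<delta>) + t)" using \<delta> by (simp add: field_simps)
    finally show ?thesis .
  qed
  have "LIM \<delta> at_right 0. - ln (\<delta> :: real) :> at_top"
    using ln_at_0 by (simp add: filterlim_uminus_at_top)
  then have "((\<lambda>\<delta>. ln E / (- ln \<delta>) + t) \<longlongrightarrow> 0 + t) (at_right 0)"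
    by (intro tendsto_intros real_tendsto_divide_at_top[OF tendsto_const])
  then have "((\<lambda>\<delta>. ereal (ln E / (- ln \<delta>) + t)) \<longlongrightarrow> ereal t) (at_right 0)" by simp
  then have lim: "Limsup (at_right 0) (\<lambda>\<delta>. ereal (ln E / (- ln \<delta>) + t)) = ereal t"
    by (intro lim_imp_Limsup) simp
  have "eventually (\<lambda>\<delta>::real. \<delta> \<in> {0<..<1}) (at_right 0)"
    by (rule eventually_at_right_real) simp
  then have "eventually (\<lambda>\<delta>. eln (covering_number \<delta> A) / ereal (- ln \<delta>)
      \<le> ereal (ln E / (- ln \<delta>) + t)) (at_right 0)"
    by eventually_elim (use bound in auto)
  then have "upper_box_dim A \<le> Limsup (at_right 0) (\<lambda>\<delta>. ereal (ln E / (- ln \<delta>) + t))"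
    unfolding upper_box_dim_def by (rule Limsup_mono)
  with lim show ?thesis by simp
qed

lemma lower_le_upper_box_dim: "lower_box_dim A \<le> upper_box_dim A"
  unfolding lower_box_dim_def upper_box_dim_def by (intro Liminf_le_Limsup) simp

lemma hausdorff_premeasure_le_balls:
  assumes "finite F" "A \<subseteq> (\<Union>x\<in>F. ball x r)" "0 < r" "2 * r \<le> \<delta>" "s > 0"
  shows "hausdorff_premeasure s \<delta> A \<le> ennreal (card F * (2 * r) powr s)"
proof -
  obtain g where g: "bij_betw g {0..<card F} F"
    using ex_bij_betw_nat_finite[OF assms(1)] by blast
  define U where "U i = (if i < card F then ball (g i) r else {})" for i
  have diam: "diameter (U i) \<le> 2 * r" for i
    using diameter_ball_le_metric[of r "g i"] assms(3) by (simp add: U_def)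
  have "A \<subseteq> (\<Union>i. U i)"
  proof
    fix a assume "a \<in> A"
    then obtain x where "x \<in> F" "a \<in> ball x r" using assms(2) by blast
    moreover then obtain i where "i < card F" "g i = x"
      using g unfolding bij_betw_def by (metis atLeastLessThan_iff imageE)
    ultimately show "a \<in> (\<Union>i. U i)" by (auto simp: U_def intro!: exI[of _ i])
  qed
  moreover have "bounded (U i) \<and> diameter (U i) \<le> \<delta>" for i
    using order_trans[OF diam assms(4)] by (simp add: U_def)
  ultimately have "hausdorff_premeasure s \<delta> A \<le> (\<Sum>i. diam_pow s (U i))"
    unfolding hausdorff_premeasure_def by (intro INF_lower) simp
  also have "\<dots> = (\<Sum>i<card F. diam_pow s (U i))"
    by (rule suminf_finite) (auto simp: U_def diam_pow_def)
  also have "\<dots> \<le> (\<Sum>i<card F. ennreal ((2 * r) powr s))"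
  proof (rule sum_mono)
    fix i
    have "diameter (U i) powr s \<le> (2 * r) powr s"
      using diam[of i] assms by (intro powr_mono2) (auto simp: U_def intro: diameter_ge_0)
    then show "diam_pow s (U i) \<le> ennreal ((2 * r) powr s)"
      using assms(5) by (simp add: diam_pow_def ennreal_leI)
  qed
  also have "\<dots> = ennreal (card F * (2 * r) powr s)"
    by (simp add: ennreal_mult ennreal_of_nat_eq_real_of_nat)
  finally show ?thesis .
qed

text \<open>
  Below the lower box dimension nothing has to be shown; for \<open>t\<close> above it there are arbitrarily
  small \<open>\<delta>\<close> at which at most \<open>\<delta> powr (- t)\<close> balls suffice, and these balls have total
  \<open>s\<close>-content of order \<open>\<delta> powr (s - t)\<close>, which vanishes in the limit for every \<open>s > t\<close>.
\<close>
lemma hausdorff_dim_le_lower_box_dim: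
  assumes "A \<noteq> {}"
  shows "hausdorff_dim A \<le> lower_box_dim A"
proof (rule ccontr)
  assume "\<not> hausdorff_dim A \<le> lower_box_dim A"
  then have "lower_box_dim A < hausdorff_dim A" by simp
  then obtain t where t: "lower_box_dim A < ereal t" "ereal t < hausdorff_dim A"
    using ereal_dense2 by blast
  from t(2) obtain s where s: "ereal t < ereal s" "ereal s < hausdorff_dim A"
    using ereal_dense2 by blast
  have ts: "t < s" using s(1) by simp
  let ?q = "\<lambda>\<delta>. eln (covering_number \<delta> A) / ereal (- ln \<delta>)"
  have freq: "\<exists>\<delta>>0. \<delta> < e \<and> \<delta> < 1 \<and> ?q \<delta> < ereal t" if e: "e > 0" for e
  proof (rule ccontr)
    assume neg: "\<not> ?thesis"
    have "eventually (\<lambda>\<delta>. \<delta> \<in> {0<..<min e 1}) (at_right (0::real))"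
      using e by (intro eventually_at_right_real) simp
    then have "eventually (\<lambda>\<delta>. ereal t \<le> ?q \<delta>) (at_right 0)"
      by eventually_elim (use neg in \<open>force simp: not_less\<close>)
    then have "ereal t \<le> lower_box_dim A" unfolding lower_box_dim_def by (rule Liminf_bounded)
    with t(1) show False by simp
  qed
  have small: "\<exists>F. finite F \<and> A \<subseteq> (\<Union>x\<in>F. ball x \<delta>) \<and> card F \<le> \<delta> powr (- t)"
    if \<delta>: "0 < \<delta>" "\<delta> < 1" and q: "?q \<delta> < ereal t" for \<delta>
  proof -
    have "eln (covering_number \<delta> A) < ereal t * ereal (- ln \<delta>)"
      using q \<delta> by (subst (asm) ereal_divide_less_iff) auto
    then have "covering_number \<delta> A < ennreal (exp (t * (- ln \<delta>)))"
      by (intro less_exp_of_eln_less) simp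
    also have "exp (t * (- ln \<delta>)) = \<delta> powr (- t)" using \<delta> by (simp add: powr_def)
    finally obtain F where "finite F" "A \<subseteq> (\<Union>x\<in>F. ball x \<delta>)"
      and lt: "(of_nat (card F) :: ennreal) < ennreal (\<delta> powr (- t))"
      unfolding covering_number_def INF_less_iff by blast
    moreover have "real (card F) \<le> \<delta> powr (- t)"
      using lt by (simp add: ennreal_of_nat_eq_real_of_nat ennreal_less_iff)
    ultimately show ?thesis by blast
  qed
  \<comment> \<open>The logarithm of a covering number of a nonempty set is nonnegative, so the box
    dimensions cannot be negative.\<close>
  have s0: "s > 0"
  proof -
    obtain \<delta> where \<delta>: "\<delta> > 0" "\<delta> < 1" "?q \<delta> < ereal t" using freq[of 1] by auto
    have "eln 1 \<le> eln (covering_number \<delta> A)" by (intro eln_mono covering_number_ge_1 assms)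
    then have "0 \<le> eln (covering_number \<delta> A)" using eln_ennreal[of 1] by (simp add: zero_ereal_def)
    then have "0 \<le> ?q \<delta>" using \<delta> by (simp add: zero_le_divide_ereal)
    then have "0 < ereal t" using \<delta>(3) by (rule order_le_less_trans)
    with ts show ?thesis by simp
  qed
  have zero: "hausdorff_premeasure s d A = 0" if d: "d > 0" for d
  proof -
    have "hausdorff_premeasure s d A \<le> 0 + ennreal e" if e: "e > 0" for e
    proof -
      \<comment> \<open>The value of \<open>\<delta>\<close> at which \<open>2 powr s * \<delta> powr (s - t)\<close> equals \<open>e\<close>.\<close>
      define \<eta> where "\<eta> = (e / 2 powr s) powr (1 / (s - t))"
      have "\<eta> > 0" using e by (simp add: \<eta>_def)
      then obtain \<delta> where \<delta>: "\<delta> > 0" "\<delta> < min (d / 2) \<eta>" "\<delta> < 1" "?q \<delta> < ereal t"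
        using freq[of "min (d / 2) \<eta>"] d by auto
      obtain F where F: "finite F" "A \<subseteq> (\<Union>x\<in>F. ball x \<delta>)" "card F \<le> \<delta> powr (- t)"
        using small[OF \<delta>(1,3,4)] by blast
      have "card F * (2 * \<delta>) powr s \<le> \<delta> powr (- t) * (2 * \<delta>) powr s"
        using F(3) by (intro mult_right_mono) auto
      also have "\<dots> = 2 powr s * \<delta> powr (s - t)"
        using \<delta>(1) by (simp add: powr_mult powr_diff powr_minus field_simps)
      also have "\<dots> \<le> 2 powr s * \<eta> powr (s - t)"
        using \<delta> ts by (intro mult_left_mono powr_mono2) auto
      also have "\<dots> = e" using e ts by (simp add: \<eta>_def powr_powr)
      finally have "ennreal (card F * (2 * \<delta>) powr s) \<le> ennreal e" by (rule ennreal_leI)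
      moreover have "hausdorff_premeasure s d A \<le> ennreal (card F * (2 * \<delta>) powr s)"
        using \<delta> s0 by (intro hausdorff_premeasure_le_balls F) auto
      ultimately show ?thesis by simp
    qed
    then have "hausdorff_premeasure s d A \<le> 0" by (rule ennreal_le_epsilon)
    then show ?thesis by simp
  qed
  then have "hausdorff_outer_measure s A = 0"
    unfolding hausdorff_outer_measure_def by (auto intro!: antisym SUP_least)
  then have "hausdorff_dim A \<le> ereal s"
    unfolding hausdorff_dim_def using s0 by (intro INF_lower) simp
  with s(2) show False by simp
qed

text \<open>
  Compactness turns a countable cover of small content into a finite cover by open balls, once
  each covering set has been enlarged to a ball.  Enlarging also removes sets of diameter \<open>0\<close>,
  which would give degenerate balls.
\<close>
lemma hausdorff_null_ball_covers:
  assumes "compact A" "A \<noteq> {}" "t \<ge> 0" and null: "hausdorff_outer_measure t A = 0"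
    and "\<delta> > 0" "\<eta> > 0"
  shows "\<exists>F :: ('a::metric_space \<times> real) set. finite F \<and>
      (\<forall>(x, \<rho>)\<in>F. x \<in> A \<and> 0 < \<rho> \<and> \<rho> < \<delta>) \<and> A \<subseteq> (\<Union>(x, \<rho>)\<in>F. ball x \<rho>) \<and>
      (\<Sum>(x, \<rho>)\<in>F. \<rho> powr t) \<le> \<eta>"
proof -
  have pre: "hausdorff_premeasure t (\<delta> / 4) A = 0"
  proof -
    have "hausdorff_premeasure t (\<delta> / 4) A \<le> hausdorff_outer_measure t A"
      unfolding hausdorff_outer_measure_def using \<open>\<delta> > 0\<close> by (intro SUP_upper) simp
    with null show ?thesis by simp
  qed
  define \<theta> where "\<theta> = \<eta> / (4 * 2 powr t)"
  have \<theta>: "\<theta> > 0" using \<open>\<eta> > 0\<close> by (simp add: \<theta>_def)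
  have "hausdorff_premeasure t (\<delta> / 4) A < ennreal (min 1 (2 * \<theta>))" using pre \<theta> by simp
  then obtain U :: "nat \<Rightarrow> 'a set" where U: "\<And>i. bounded (U i)" "\<And>i. diameter (U i) \<le> \<delta> / 4"
    "A \<subseteq> (\<Union>i. U i)" and sumU: "(\<Sum>i. diam_pow t (U i)) < ennreal (min 1 (2 * \<theta>))"
    unfolding hausdorff_premeasure_def INF_less_iff by blast
  have part: "(\<Sum>i\<in>J. diam_pow t (U i)) < ennreal (min 1 (2 * \<theta>))" if "finite J" for J
    using sum_le_suminf[of "\<lambda>i. diam_pow t (U i)" J] that sumU by (auto intro: le_less_trans)
  \<comment> \<open>For exponent \<open>0\<close> every nonempty covering set contributes \<open>1\<close>, so null sets are empty.\<close>
  have t: "t > 0"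
  proof (rule ccontr)
    assume "\<not> t > 0"
    then have t0: "t = 0" using assms(3) by simp
    obtain a i where "a \<in> A" "a \<in> U i" using assms(2) U(3) by blast
    then have "diam_pow t (U i) = 1" by (auto simp: diam_pow_def t0)
    with part[of "{i}"] have "ennreal 1 < ennreal (min 1 (2 * \<theta>))" by simp
    then show False using \<theta> by (simp add: ennreal_less_iff del: ennreal_1)
  qed
  \<comment> \<open>A summable lower bound for the radii: the terms \<open>\<sigma> i powr t\<close> add up to at most \<open>2 * \<theta>\<close>,
    as do the terms coming from the diameters.\<close>
  define \<sigma> where "\<sigma> i = min (\<delta> / 4) ((\<theta> * (1/2) ^ i) powr (1 / t))" for i :: nat
  define \<rho> where "\<rho> i = 2 * max (diameter (U i)) (\<sigma> i)" for i
  have \<sigma>: "\<sigma> i > 0" "\<sigma> i powr t \<le> \<theta> * (1/2) ^ i" for i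
  proof -
    show pos: "\<sigma> i > 0" using \<theta> \<open>\<delta> > 0\<close> by (simp add: \<sigma>_def)
    have "\<sigma> i powr t \<le> ((\<theta> * (1/2) ^ i) powr (1 / t)) powr t"
      using pos t by (intro powr_mono2) (auto simp: \<sigma>_def)
    also have "\<dots> = \<theta> * (1/2) ^ i" using \<theta> t by (simp add: powr_powr)
    finally show "\<sigma> i powr t \<le> \<theta> * (1/2) ^ i" .
  qed
  have d0: "diameter (U i) \<ge> 0" for i using U(1) by (rule diameter_ge_0)
  have \<rho>: "0 < \<rho> i" "\<rho> i < \<delta>" "diameter (U i) < \<rho> i" for i
  proof -
    have "max (diameter (U i)) (\<sigma> i) \<le> \<delta> / 4"
      using U(2)[of i] unfolding \<sigma>_def by (intro max.boundedI min.cobounded1)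
    then show "\<rho> i < \<delta>" using \<open>\<delta> > 0\<close> by (simp add: \<rho>_def)
    show "0 < \<rho> i" "diameter (U i) < \<rho> i" using \<sigma>(1)[of i] d0[of i] by (auto simp: \<rho>_def max_def)
  qed
  have \<rho>_pow: "\<rho> i powr t \<le> 2 powr t * (diameter (U i) powr t + \<theta> * (1/2) ^ i)" for i
  proof -
    have "\<rho> i powr t = 2 powr t * max (diameter (U i)) (\<sigma> i) powr t"
      by (simp add: \<rho>_def powr_mult)
    moreover have "max (diameter (U i)) (\<sigma> i) powr t \<le> diameter (U i) powr t + \<sigma> i powr t"
      by (simp add: max_def)
    ultimately show ?thesis using \<sigma>(2)[of i] by (simp add: mult_left_mono)
  qed
  define J where "J = {i. U i \<inter> A \<noteq> {}}"
  define c where "c i = (SOME x. x \<in> U i \<inter> A)" for i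
  have c: "c i \<in> U i \<inter> A" if "i \<in> J" for i
    using that unfolding c_def J_def by (simp add: some_in_eq del: Int_iff)
  have "A \<subseteq> (\<Union>i\<in>J. ball (c i) (\<rho> i))"
  proof
    fix a assume a: "a \<in> A"
    then obtain i where i: "a \<in> U i" using U(3) by blast
    then have "i \<in> J" using a by (auto simp: J_def)
    then have "dist (c i) a \<le> diameter (U i)" using c i by (intro diameter_bounded_bound U(1)) auto
    then have "a \<in> ball (c i) (\<rho> i)" using \<rho>(3)[of i] by simp
    with \<open>i \<in> J\<close> show "a \<in> (\<Union>i\<in>J. ball (c i) (\<rho> i))" by blast
  qed
  then obtain J' where J': "J' \<subseteq> J" "finite J'" "A \<subseteq> (\<Union>i\<in>J'. ball (c i) (\<rho> i))"
    by (rule compactE_image[OF assms(1), of J "\<lambda>i. ball (c i) (\<rho> i)", rotated]) auto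
  define F where "F = (\<lambda>i. (c i, \<rho> i)) ` J'"
  have sum_d: "(\<Sum>i\<in>J'. diameter (U i) powr t) \<le> 2 * \<theta>"
  proof -
    have "ennreal (\<Sum>i\<in>J'. diameter (U i) powr t) = (\<Sum>i\<in>J'. ennreal (diameter (U i) powr t))"
      by (simp add: sum_ennreal)
    also have "\<dots> = (\<Sum>i\<in>J'. diam_pow t (U i))"
      using J'(1) t by (intro sum.cong) (auto simp: diam_pow_def J_def)
    also have "\<dots> < ennreal (min 1 (2 * \<theta>))" by (rule part[OF J'(2)])
    also have "\<dots> \<le> ennreal (2 * \<theta>)" by (intro ennreal_leI) simp
    finally show ?thesis using \<theta> by (simp add: ennreal_less_iff sum_nonneg)
  qed
  have sum_g: "(\<Sum>i\<in>J'. \<theta> * (1/2) ^ i) \<le> 2 * \<theta>"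
  proof -
    have "(\<Sum>i\<in>J'. (1/2::real) ^ i) \<le> (\<Sum>i. (1/2) ^ i)"
      by (rule sum_le_suminf) (auto simp: J'(2) summable_geometric)
    also have "\<dots> = 2" by (simp add: suminf_geometric)
    finally show ?thesis using \<theta> by (simp flip: sum_distrib_left)
  qed
  have "(\<Sum>(x, r)\<in>F. r powr t) \<le> (\<Sum>i\<in>J'. \<rho> i powr t)"
    unfolding F_def
    by (rule order_trans[OF sum_image_le]) (auto simp: J'(2))
  also have "\<dots> \<le> (\<Sum>i\<in>J'. 2 powr t * (diameter (U i) powr t + \<theta> * (1/2) ^ i))"
    by (intro sum_mono \<rho>_pow)
  also have "\<dots> = 2 powr t * ((\<Sum>i\<in>J'. diameter (U i) powr t) + (\<Sum>i\<in>J'. \<theta> * (1/2) ^ i))"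
    by (simp only: sum.distrib flip: sum_distrib_left)
  also have "\<dots> \<le> 2 powr t * (4 * \<theta>)" using sum_d sum_g by (intro mult_left_mono) auto
  also have "\<dots> = \<eta>" by (simp add: \<theta>_def)
  finally have "(\<Sum>(x, r)\<in>F. r powr t) \<le> \<eta>" .
  moreover have "finite F" using J'(2) by (simp add: F_def)
  moreover have "\<forall>(x, r)\<in>F. x \<in> A \<and> 0 < r \<and> r < \<delta>" using J'(1) c \<rho> by (auto simp: F_def)
  moreover have "A \<subseteq> (\<Union>(x, r)\<in>F. ball x r)" using J'(3) by (simp add: F_def)
  ultimately show ?thesis by blast
qed

section \<open>Conformal maps of a compact space and their iterates\<close>

definition deriv_prod :: "('a \<Rightarrow> 'a) \<Rightarrow> ('a \<Rightarrow> real) \<Rightarrow> nat \<Rightarrow> 'a \<Rightarrow> real" where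
  "deriv_prod f D n x = (\<Prod>k<n. D ((f ^^ k) x))"

lemma deriv_prod_0 [simp]: "deriv_prod f D 0 x = 1"
  by (simp add: deriv_prod_def)

lemma deriv_prod_Suc: "deriv_prod f D (Suc n) x = deriv_prod f D n x * D ((f ^^ n) x)"
  by (simp add: deriv_prod_def)

lemma deriv_prod_add:
  "deriv_prod f D (m + n) x = deriv_prod f D m x * deriv_prod f D n ((f ^^ m) x)"
proof (induction n)
  case (Suc n)
  have "(f ^^ (m + n)) x = (f ^^ n) ((f ^^ m) x)"
    unfolding add.commute[of m n] by (simp add: funpow_add)
  with Suc show ?case by (simp add: deriv_prod_Suc)
qed simp

lemma deriv_prod_iterate:
  "deriv_prod (f ^^ q) (deriv_prod f D q) n x = deriv_prod f D (q * n) x"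
proof (induction n)
  case (Suc n)
  have "deriv_prod f D (q * Suc n) x = deriv_prod f D (q * n + q) x"
    by (simp add: add.commute)
  with Suc show ?case
    by (simp add: deriv_prod_Suc deriv_prod_add funpow_mult mult.commute[of n] del: mult_Suc mult_Suc_right)
qed simp

text \<open>
  The error is multiplicative so that it accumulates to \<open>exp (\<epsilon> * n)\<close> over \<open>n\<close> steps of an orbit.
\<close>
definition almost_conformal ::
    "'a::metric_space set \<Rightarrow> ('a \<Rightarrow> 'a) \<Rightarrow> ('a \<Rightarrow> real) \<Rightarrow> real \<Rightarrow> real \<Rightarrow> bool" where
  "almost_conformal \<Lambda> f D \<epsilon> r \<longleftrightarrow> (\<forall>u\<in>\<Lambda>. \<forall>v\<in>\<Lambda>. dist u v < r \<longrightarrow>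
     exp (- \<epsilon>) * D u * dist u v \<le> dist (f u) (f v) \<and>
     dist (f u) (f v) \<le> exp \<epsilon> * D u * dist u v)"

lemma almost_conformalD:
  assumes "almost_conformal \<Lambda> f D \<epsilon> r" "u \<in> \<Lambda>" "v \<in> \<Lambda>" "dist u v < r"
  shows "exp (- \<epsilon>) * D u * dist u v \<le> dist (f u) (f v)"
    and "dist (f u) (f v) \<le> exp \<epsilon> * D u * dist u v"
  using assms unfolding almost_conformal_def by blast+

text \<open>
  The hypotheses are stated in the uniform form that compactness provides.  In contrast to the
  pointwise double limit, this form passes to iterates by a direct estimate.
\<close>
locale conformal_map =
  fixes \<Lambda> :: "'a::metric_space set" and f :: "'a \<Rightarrow> 'a" and D :: "'a \<Rightarrow> real"
  assumes nonempty: "\<Lambda> \<noteq> {}" and compact: "compact \<Lambda>"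
    and cont: "continuous_on \<Lambda> f" and surj: "f ` \<Lambda> = \<Lambda>"
    and open_f: "open_map (top_of_set \<Lambda>) (top_of_set \<Lambda>) f"
    and bounded_below: "\<exists>m>0. \<forall>x\<in>\<Lambda>. m \<le> D x"
    and bounded_above: "\<exists>M. \<forall>x\<in>\<Lambda>. D x \<le> M"
    and conformal: "\<And>\<epsilon>. \<epsilon> > 0 \<Longrightarrow> \<exists>r>0. almost_conformal \<Lambda> f D \<epsilon> r"
begin

lemma pos: "x \<in> \<Lambda> \<Longrightarrow> D x > 0"
  using bounded_below by force

lemma funpow_in: "x \<in> \<Lambda> \<Longrightarrow> (f ^^ n) x \<in> \<Lambda>"
  by (induction n) (use surj in auto)

lemma deriv_prod_pos: "x \<in> \<Lambda> \<Longrightarrow> deriv_prod f D n x > 0"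
  by (auto simp: deriv_prod_def intro!: prod_pos pos funpow_in)

text \<open>
  Comparing the two estimates for \<open>dist (f u) (f v)\<close> that are based at \<open>u\<close> and at \<open>v\<close> shows
  that \<open>D\<close> varies little; continuity of \<open>D\<close> is implicit in almost conformality.
\<close>
lemma deriv_distortion:
  assumes ac: "almost_conformal \<Lambda> f D \<epsilon> r" and "\<epsilon> > 0" and uv: "u \<in> \<Lambda>" "v \<in> \<Lambda>" "dist u v < r"
  shows "exp (- (2 * \<epsilon>)) * D u \<le> D v"
proof (cases "u = v")
  case True
  then show ?thesis using pos[OF uv(1)] assms(2) by (simp add: mult_le_cancel_right1)
next
  case False
  have "exp (- \<epsilon>) * D u * dist u v \<le> dist (f u) (f v)"
    using almost_conformalD(1)[OF ac uv] .
  also have "\<dots> = dist (f v) (f u)" by (rule dist_commute)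
  also have "\<dots> \<le> exp \<epsilon> * D v * dist v u"
    using almost_conformalD(2)[OF ac uv(2,1)] uv(3) by (simp add: dist_commute)
  also have "\<dots> = exp \<epsilon> * D v * dist u v" by (simp add: dist_commute)
  finally have "exp (- \<epsilon>) * D u \<le> exp \<epsilon> * D v"
    using False by simp
  then have "exp (- \<epsilon>) * (exp (- \<epsilon>) * D u) \<le> exp (- \<epsilon>) * (exp \<epsilon> * D v)" by simp
  then show ?thesis by (simp add: mult.assoc[symmetric] flip: exp_add)
qed

end

lemma conformal_map_id:
  assumes "\<Lambda> \<noteq> {}" "compact \<Lambda>"
  shows "conformal_map \<Lambda> id (\<lambda>_. 1)"
proof
  show "\<exists>m>0::real. \<forall>x\<in>\<Lambda>. m \<le> 1" by (intro exI[of _ 1]) auto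
  fix e :: real assume "e > 0"
  then have "exp (- e) * d \<le> d \<and> d \<le> exp e * d" if "d \<ge> 0" for d
    using that by (simp add: mult_le_cancel_right1 mult_le_cancel_right2)
  then show "\<exists>r>0. almost_conformal \<Lambda> id (\<lambda>_. 1) e r"
    by (intro exI[of _ 1]) (simp add: almost_conformal_def)
qed (use assms in \<open>auto simp: open_map_def\<close>)

text \<open>
  The chain rule; half of the admissible error is granted to each map.
\<close>
lemma conformal_map_compose:
  assumes "conformal_map \<Lambda> g E" "conformal_map \<Lambda> f D"
  shows "conformal_map \<Lambda> (g \<circ> f) (\<lambda>x. D x * E (f x))"
proof -
  interpret g: conformal_map \<Lambda> g E by fact
  interpret f: conformal_map \<Lambda> f D by fact
  have in_f: "f x \<in> \<Lambda>" if "x \<in> \<Lambda>" for x using f.surj that by blast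
  show ?thesis
  proof
    show "continuous_on \<Lambda> (g \<circ> f)"
      using f.cont g.cont f.surj by (intro continuous_on_compose) auto
    show "(g \<circ> f) ` \<Lambda> = \<Lambda>" by (simp add: f.surj g.surj flip: image_image image_comp)
    show "open_map (top_of_set \<Lambda>) (top_of_set \<Lambda>) (g \<circ> f)"
      using f.open_f g.open_f by (rule open_map_compose)
    obtain m n where "m > 0" "n > 0" "\<forall>x\<in>\<Lambda>. m \<le> D x" "\<forall>x\<in>\<Lambda>. n \<le> E x"
      using f.bounded_below g.bounded_below by blast
    then show "\<exists>m>0. \<forall>x\<in>\<Lambda>. m \<le> D x * E (f x)"
      using in_f f.pos by (intro exI[of _ "m * n"]) (force intro!: mult_mono)
    obtain M N where "\<forall>x\<in>\<Lambda>. D x \<le> M" "\<forall>x\<in>\<Lambda>. E x \<le> N"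
      using f.bounded_above g.bounded_above by blast
    then have "D x * E (f x) \<le> M * N" if "x \<in> \<Lambda>" for x
      using that in_f f.pos[OF that] g.pos[OF in_f[OF that]] by (intro mult_mono) force+
    then show "\<exists>M. \<forall>x\<in>\<Lambda>. D x * E (f x) \<le> M" by blast
  next
    fix e :: real assume "e > 0"
    then have e: "e / 2 > 0" by simp
    obtain r where r: "r > 0" and rD: "almost_conformal \<Lambda> f D (e/2) r"
      using f.conformal[OF e] by blast
    obtain \<rho> where \<rho>: "\<rho> > 0" and \<rho>E: "almost_conformal \<Lambda> g E (e/2) \<rho>"
      using g.conformal[OF e] by blast
    obtain d where d: "d > 0" "\<And>u v. u \<in> \<Lambda> \<Longrightarrow> v \<in> \<Lambda> \<Longrightarrow> dist v u < d \<Longrightarrow> dist (f v) (f u) < \<rho>"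
      using compact_uniformly_continuous[OF f.cont f.compact] \<rho>
      unfolding uniformly_continuous_on_def by blast
    have "exp (- e) * (D u * E (f u)) * dist u v \<le> dist ((g \<circ> f) u) ((g \<circ> f) v) \<and>
           dist ((g \<circ> f) u) ((g \<circ> f) v) \<le> exp e * (D u * E (f u)) * dist u v"
      if uv: "u \<in> \<Lambda>" "v \<in> \<Lambda>" "dist u v < min r d" for u v
    proof
      note fuv = in_f[OF uv(1)] in_f[OF uv(2)]
      have close: "dist (f u) (f v) < \<rho>" using d(2)[OF uv(2,1)] uv(3) by simp
      have "exp (- e) * (D u * E (f u)) * dist u v
          = exp (- (e/2)) * E (f u) * (exp (- (e/2)) * D u * dist u v)"
        by (simp add: mult_ac flip: exp_add)
      also have "\<dots> \<le> exp (- (e/2)) * E (f u) * dist (f u) (f v)"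
        using almost_conformalD(1)[OF rD uv(1,2)] uv(3) g.pos[OF fuv(1)] by (intro mult_left_mono) auto
      also have "\<dots> \<le> dist (g (f u)) (g (f v))" using almost_conformalD(1)[OF \<rho>E fuv close] .
      finally show "exp (- e) * (D u * E (f u)) * dist u v \<le> dist ((g \<circ> f) u) ((g \<circ> f) v)"
        by simp
      have "dist (g (f u)) (g (f v)) \<le> exp (e/2) * E (f u) * dist (f u) (f v)"
        using almost_conformalD(2)[OF \<rho>E fuv close] .
      also have "\<dots> \<le> exp (e/2) * E (f u) * (exp (e/2) * D u * dist u v)"
        using almost_conformalD(2)[OF rD uv(1,2)] uv(3) g.pos[OF fuv(1)] by (intro mult_left_mono) auto
      also have "\<dots> = exp e * (D u * E (f u)) * dist u v"
        by (simp add: mult_ac flip: exp_add)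
      finally show "dist ((g \<circ> f) u) ((g \<circ> f) v) \<le> exp e * (D u * E (f u)) * dist u v" by simp
    qed
    then show "\<exists>r>0. almost_conformal \<Lambda> (g \<circ> f) (\<lambda>x. D x * E (f x)) e r"
      using r d(1) unfolding almost_conformal_def by (intro exI[of _ "min r d"] conjI) (simp, blast)
  qed (use f.nonempty f.compact in auto)
qed

lemma (in conformal_map) conformal_map_iterate:
  "conformal_map \<Lambda> (f ^^ q) (deriv_prod f D q)"
proof (induction q)
  case 0
  then show ?case using conformal_map_id[OF nonempty compact]
    by (simp add: deriv_prod_def id_def)
next
  case (Suc q)
  have "deriv_prod f D (Suc q) = (\<lambda>x. deriv_prod f D q x * D ((f ^^ q) x))"
    by (simp add: fun_eq_iff deriv_prod_Suc)
  then show ?case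
    using conformal_map_compose[OF conformal_map_axioms Suc] by (simp add: comp_def)
qed

section \<open>Sums over fibres\<close>

definition fibre :: "'a set \<Rightarrow> ('a \<Rightarrow> 'a) \<Rightarrow> nat \<Rightarrow> 'a \<Rightarrow> 'a set" where
  "fibre \<Lambda> f n y = {x \<in> \<Lambda>. (f ^^ n) x = y}"

definition fibre_sum ::
    "'a set \<Rightarrow> ('a \<Rightarrow> 'a) \<Rightarrow> ('a \<Rightarrow> real) \<Rightarrow> real \<Rightarrow> nat \<Rightarrow> 'a \<Rightarrow> real" where
  "fibre_sum \<Lambda> f D s n y = (\<Sum>x\<in>fibre \<Lambda> f n y. deriv_prod f D n x powr (- s))"

definition fibre_sup :: "'a set \<Rightarrow> ('a \<Rightarrow> 'a) \<Rightarrow> ('a \<Rightarrow> real) \<Rightarrow> real \<Rightarrow> nat \<Rightarrow> real" where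
  "fibre_sup \<Lambda> f D s n = (SUP y\<in>\<Lambda>. fibre_sum \<Lambda> f D s n y)"

lemma fibre_sup_iterate:
  "fibre_sup \<Lambda> (f ^^ q) (deriv_prod f D q) s n = fibre_sup \<Lambda> f D s (q * n)"
  by (simp add: fibre_sup_def fibre_sum_def fibre_def deriv_prod_iterate funpow_mult mult.commute)

lemma fibre_subset: "fibre \<Lambda> f n y \<subseteq> \<Lambda>"
  by (auto simp: fibre_def)

context conformal_map
begin

lemma finite_net:
  assumes "r > 0"
  obtains F where "finite F" "F \<subseteq> \<Lambda>" "\<Lambda> \<subseteq> (\<Union>x\<in>F. ball x r)"
  using compactE_image[OF compact, of \<Lambda> "\<lambda>x. ball x r"] assms
  by (metis UN_I centre_in_ball open_ball subsetI)

lemma locally_injective: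
  obtains r where "r > 0"
    "\<And>u v. u \<in> \<Lambda> \<Longrightarrow> v \<in> \<Lambda> \<Longrightarrow> dist u v < r \<Longrightarrow> f u = f v \<Longrightarrow> u = v"
proof -
  obtain r where r: "r > 0" "almost_conformal \<Lambda> f D 1 r"
    using conformal[of 1] by auto
  have "u = v" if uv: "u \<in> \<Lambda>" "v \<in> \<Lambda>" "dist u v < r" "f u = f v" for u v
  proof -
    have "exp (- 1) * D u * dist u v \<le> 0"
      using almost_conformalD(1)[OF r(2) uv(1-3)] uv(4) by simp
    then show ?thesis using pos[OF uv(1)]
      by (simp add: mult_le_0_iff zero_less_mult_iff not_less[symmetric])
  qed
  with r(1) that show thesis by blast
qed

text \<open>
  Points of one fibre are separated by the injectivity radius, so they choose distinct points
  of a net that is fine at this scale.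
\<close>
lemma card_fibre_1_bounded:
  obtains K where "\<And>y. finite (fibre \<Lambda> f 1 y)" "\<And>y. card (fibre \<Lambda> f 1 y) \<le> (K :: nat)"
proof -
  obtain r where r: "r > 0"
    and inj: "\<And>u v. u \<in> \<Lambda> \<Longrightarrow> v \<in> \<Lambda> \<Longrightarrow> dist u v < r \<Longrightarrow> f u = f v \<Longrightarrow> u = v"
    using locally_injective by metis
  obtain F where F: "finite F" "F \<subseteq> \<Lambda>" "\<Lambda> \<subseteq> (\<Union>x\<in>F. ball x (r/2))"
    using finite_net[of "r/2"] r by auto
  then have "\<forall>x\<in>\<Lambda>. \<exists>c\<in>F. dist c x < r/2" by (auto simp: subset_iff)
  then obtain c where c: "\<And>x. x \<in> \<Lambda> \<Longrightarrow> c x \<in> F \<and> dist (c x) x < r/2" by metis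
  have "inj_on c (fibre \<Lambda> f 1 y)" for y
  proof (rule inj_onI)
    fix u v assume uv: "u \<in> fibre \<Lambda> f 1 y" "v \<in> fibre \<Lambda> f 1 y" "c u = c v"
    then have mem: "u \<in> \<Lambda>" "v \<in> \<Lambda>" "f u = f v" by (auto simp: fibre_def)
    have "dist u v \<le> dist (c u) u + dist (c v) v"
      using uv(3) dist_triangle2[of u v "c u"] by (simp add: dist_commute)
    with c[OF mem(1)] c[OF mem(2)] have "dist u v < r" by simp
    with inj mem show "u = v" by blast
  qed
  moreover have "c ` fibre \<Lambda> f 1 y \<subseteq> F" for y using c by (auto simp: fibre_def)
  ultimately show thesis
    using F(1) that[of "card F"] inj_on_finite card_inj_on_le by metis
qed

lemma fibre_add: "fibre \<Lambda> f (m + n) y = (\<Union>x\<in>fibre \<Lambda> f n y. fibre \<Lambda> f m x)"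
  using funpow_in[of _ m] by (auto simp: fibre_def funpow_add add.commute[of m])

lemma finite_fibre: "finite (fibre \<Lambda> f n y)"
proof (induction n arbitrary: y)
  case 0
  show ?case by (simp add: fibre_def)
next
  case (Suc n)
  have "\<And>y. finite (fibre \<Lambda> f 1 y)" using card_fibre_1_bounded by metis
  then show ?case using Suc fibre_add[of 1 n y] by simp
qed

lemma fibre_sum_nonneg: "fibre_sum \<Lambda> f D s n y \<ge> 0"
  by (simp add: fibre_sum_def sum_nonneg)

text \<open>
  The semigroup law of the transfer operator, whose \<open>n\<close>-th power applied to the constant \<open>1\<close> is
  \<open>fibre_sum \<Lambda> f D s n\<close>.
\<close>
lemma fibre_sum_add:
  "fibre_sum \<Lambda> f D s (m + n) y =
     (\<Sum>x\<in>fibre \<Lambda> f n y. deriv_prod f D n x powr (- s) * fibre_sum \<Lambda> f D s m x)"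
proof -
  have "fibre_sum \<Lambda> f D s (m + n) y =
      (\<Sum>x\<in>fibre \<Lambda> f n y. \<Sum>w\<in>fibre \<Lambda> f m x. deriv_prod f D (m + n) w powr (- s))"
    unfolding fibre_sum_def fibre_add
    by (rule sum.UNION_disjoint) (auto simp: finite_fibre, auto simp: fibre_def)
  also have "\<dots> = (\<Sum>x\<in>fibre \<Lambda> f n y. \<Sum>w\<in>fibre \<Lambda> f m x.
      deriv_prod f D n x powr (- s) * deriv_prod f D m w powr (- s))"
  proof (intro sum.cong refl)
    fix x w assume "x \<in> fibre \<Lambda> f n y" "w \<in> fibre \<Lambda> f m x"
    then have "w \<in> \<Lambda>" "x \<in> \<Lambda>" "(f ^^ m) w = x" by (auto simp: fibre_def)
    then show "deriv_prod f D (m + n) w powr (- s)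
        = deriv_prod f D n x powr (- s) * deriv_prod f D m w powr (- s)"
      using deriv_prod_pos by (simp add: deriv_prod_add powr_mult less_imp_le mult.commute)
  qed
  finally show ?thesis by (simp add: fibre_sum_def sum_distrib_left)
qed

lemma fibre_sum_bounded: "\<exists>B. \<forall>y. fibre_sum \<Lambda> f D s n y \<le> B"
proof (induction n)
  case 0
  have "fibre_sum \<Lambda> f D s 0 y \<le> 1" for y
    by (cases "y \<in> \<Lambda>") (auto simp: fibre_sum_def fibre_def conj_commute cong: conj_cong)
  then show ?case by blast
next
  case (Suc n)
  obtain K where K: "\<And>y. finite (fibre \<Lambda> f 1 y)" "\<And>y. card (fibre \<Lambda> f 1 y) \<le> K"
    using card_fibre_1_bounded by metis
  obtain m M where m: "m > 0" "\<forall>x\<in>\<Lambda>. m \<le> D x" and M: "\<forall>x\<in>\<Lambda>. D x \<le> M"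
    using bounded_below bounded_above by blast
  define b where "b = max (m powr (- s)) (M powr (- s))"
  have b: "D x powr (- s) \<le> b" if "x \<in> \<Lambda>" for x
  proof (cases "s \<ge> 0")
    case True
    then have "D x powr (- s) \<le> m powr (- s)" using m that by (intro powr_mono2') auto
    then show ?thesis by (simp add: b_def)
  next
    case False
    then have "D x powr (- s) \<le> M powr (- s)"
      using M m(1) that pos by (intro powr_mono2) (auto simp: less_imp_le)
    then show ?thesis by (simp add: b_def)
  qed
  have b0: "b \<ge> 0" by (simp add: b_def le_max_iff_disj)
  obtain B where B: "\<forall>y. fibre_sum \<Lambda> f D s n y \<le> B" using Suc by blast
  have B0: "B \<ge> 0" using B fibre_sum_nonneg order_trans by blast
  have "fibre_sum \<Lambda> f D s (Suc n) y \<le> K * (b * B)" for y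
  proof -
    have "fibre_sum \<Lambda> f D s (n + 1) y =
      (\<Sum>x\<in>fibre \<Lambda> f 1 y. D x powr (- s) * fibre_sum \<Lambda> f D s n x)"
      by (subst fibre_sum_add) (simp add: deriv_prod_def)
    also have "\<dots> \<le> (\<Sum>x\<in>fibre \<Lambda> f 1 y. b * B)"
      using b b0 B fibre_sum_nonneg by (intro sum_mono mult_mono) (auto simp: fibre_def)
    also have "\<dots> \<le> K * (b * B)"
      using K(2)[of y] b0 B0 by (simp add: mult_right_mono)
    finally show ?thesis by simp
  qed
  then show ?case by blast
qed

lemma fibre_sum_le_sup: "y \<in> \<Lambda> \<Longrightarrow> fibre_sum \<Lambda> f D s n y \<le> fibre_sup \<Lambda> f D s n"
  unfolding fibre_sup_def using fibre_sum_bounded[of s n]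
  by (intro cSUP_upper) (auto simp: bdd_above_def)

lemma fibre_sup_le: "(\<And>y. y \<in> \<Lambda> \<Longrightarrow> fibre_sum \<Lambda> f D s n y \<le> B) \<Longrightarrow> fibre_sup \<Lambda> f D s n \<le> B"
  unfolding fibre_sup_def by (intro cSUP_least nonempty)

lemma fibre_nonempty:
  assumes "y \<in> \<Lambda>" shows "fibre \<Lambda> f n y \<noteq> {}"
proof -
  interpret it: conformal_map \<Lambda> "f ^^ n" "deriv_prod f D n" by (rule conformal_map_iterate)
  show ?thesis using it.surj assms by (force simp: fibre_def)
qed

lemma fibre_sup_pos: "fibre_sup \<Lambda> f D s n > 0"
proof -
  obtain y where y: "y \<in> \<Lambda>" using nonempty by blast
  obtain x where x: "x \<in> fibre \<Lambda> f n y" using fibre_nonempty[OF y] by blast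
  then have "fibre_sum \<Lambda> f D s n y > 0"
    unfolding fibre_sum_def using deriv_prod_pos[of x n]
    by (intro sum_pos2[of _ x]) (auto simp: finite_fibre, auto simp: fibre_def)
  with fibre_sum_le_sup[OF y, of s n] show ?thesis by simp
qed

lemma fibre_sup_0_ge_1: "fibre_sup \<Lambda> f D 0 n \<ge> 1"
proof -
  obtain y where y: "y \<in> \<Lambda>" using nonempty by blast
  have "fibre_sum \<Lambda> f D 0 n y = (\<Sum>x\<in>fibre \<Lambda> f n y. 1)"
    unfolding fibre_sum_def
    by (intro sum.cong refl) (use deriv_prod_pos[of _ n, THEN less_imp_neq] in \<open>auto simp: fibre_def\<close>)
  also have "\<dots> \<ge> 1" using fibre_nonempty[OF y] finite_fibre by (simp add: Suc_le_eq card_gt_0_iff)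
  finally show ?thesis using fibre_sum_le_sup[OF y, of 0 n] by simp
qed

lemma fibre_sup_submult:
  "fibre_sup \<Lambda> f D s (m + n) \<le> fibre_sup \<Lambda> f D s m * fibre_sup \<Lambda> f D s n"
proof (rule fibre_sup_le)
  fix y assume y: "y \<in> \<Lambda>"
  have "fibre_sum \<Lambda> f D s (m + n) y
      \<le> (\<Sum>x\<in>fibre \<Lambda> f n y. deriv_prod f D n x powr (- s) * fibre_sup \<Lambda> f D s m)"
    unfolding fibre_sum_add
    by (intro sum_mono mult_left_mono fibre_sum_le_sup) (auto simp: fibre_def)
  also have "\<dots> = fibre_sup \<Lambda> f D s m * fibre_sum \<Lambda> f D s n y"
    by (simp add: fibre_sum_def sum_distrib_left mult.commute)
  also have "\<dots> \<le> fibre_sup \<Lambda> f D s m * fibre_sup \<Lambda> f D s n"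
    using fibre_sup_pos fibre_sum_le_sup[OF y] by (intro mult_left_mono) (auto simp: less_imp_le)
  finally show "fibre_sum \<Lambda> f D s (m + n) y \<le> fibre_sup \<Lambda> f D s m * fibre_sup \<Lambda> f D s n" .
qed

lemma fibre_sup_0: "fibre_sup \<Lambda> f D s 0 \<le> 1"
  by (rule fibre_sup_le) (auto simp: fibre_sum_def fibre_def conj_commute cong: conj_cong)

lemma fibre_sup_mult_le_power: "fibre_sup \<Lambda> f D s (k * n) \<le> fibre_sup \<Lambda> f D s n ^ k"
proof (induction k)
  case 0
  show ?case using fibre_sup_0 by simp
next
  case (Suc k)
  have "fibre_sup \<Lambda> f D s (n + k * n) \<le> fibre_sup \<Lambda> f D s n * fibre_sup \<Lambda> f D s (k * n)"
    by (rule fibre_sup_submult)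
  also have "\<dots> \<le> fibre_sup \<Lambda> f D s n * fibre_sup \<Lambda> f D s n ^ k"
    using Suc fibre_sup_pos by (intro mult_left_mono) (auto simp: less_imp_le)
  finally show ?case by simp
qed

lemma fibre_sup_shift_le:
  assumes "h \<ge> 0" "a > 0" "\<And>x. x \<in> \<Lambda> \<Longrightarrow> a \<le> deriv_prod f D n x"
  shows "fibre_sup \<Lambda> f D (s + h) n \<le> a powr (- h) * fibre_sup \<Lambda> f D s n"
proof (rule fibre_sup_le)
  fix y assume y: "y \<in> \<Lambda>"
  have "fibre_sum \<Lambda> f D (s + h) n y \<le> (\<Sum>x\<in>fibre \<Lambda> f n y. a powr (- h) * deriv_prod f D n x powr (- s))"
    unfolding fibre_sum_def
  proof (rule sum_mono)
    fix x assume "x \<in> fibre \<Lambda> f n y"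
    then have "deriv_prod f D n x powr (- h) \<le> a powr (- h)"
      using assms fibre_subset[of \<Lambda> f n y] by (intro powr_mono2') auto
    then have "deriv_prod f D n x powr (- h) * deriv_prod f D n x powr (- s)
       \<le> a powr (- h) * deriv_prod f D n x powr (- s)"
      by (rule mult_right_mono) simp
    then show "deriv_prod f D n x powr (- (s + h)) \<le> a powr (- h) * deriv_prod f D n x powr (- s)"
      by (simp add: algebra_simps flip: powr_add)
  qed
  also have "\<dots> = a powr (- h) * fibre_sum \<Lambda> f D s n y"
    by (simp add: fibre_sum_def sum_distrib_left)
  also have "\<dots> \<le> a powr (- h) * fibre_sup \<Lambda> f D s n"
    using fibre_sum_le_sup[OF y] by (intro mult_left_mono) auto
  finally show "fibre_sum \<Lambda> f D (s + h) n y \<le> a powr (- h) * fibre_sup \<Lambda> f D s n" .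
qed

lemma fibre_sup_shift_ge:
  assumes "h \<ge> 0" "\<And>x. x \<in> \<Lambda> \<Longrightarrow> deriv_prod f D n x \<le> b"
  shows "fibre_sup \<Lambda> f D s n \<le> b powr h * fibre_sup \<Lambda> f D (s + h) n"
proof (rule fibre_sup_le)
  fix y assume y: "y \<in> \<Lambda>"
  have "fibre_sum \<Lambda> f D s n y \<le> (\<Sum>x\<in>fibre \<Lambda> f n y. b powr h * deriv_prod f D n x powr (- (s + h)))"
    unfolding fibre_sum_def
  proof (rule sum_mono)
    fix x assume "x \<in> fibre \<Lambda> f n y"
    then have "x \<in> \<Lambda>" by (simp add: fibre_def)
    then have "deriv_prod f D n x powr h \<le> b powr h"
      using assms deriv_prod_pos[of x n] by (intro powr_mono2) auto
    then have "deriv_prod f D n x powr h * deriv_prod f D n x powr (- (s + h))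
       \<le> b powr h * deriv_prod f D n x powr (- (s + h))"
      by (rule mult_right_mono) simp
    then show "deriv_prod f D n x powr (- s) \<le> b powr h * deriv_prod f D n x powr (- (s + h))"
      by (simp flip: powr_add)
  qed
  also have "\<dots> = b powr h * fibre_sum \<Lambda> f D (s + h) n y"
    by (simp add: fibre_sum_def sum_distrib_left)
  also have "\<dots> \<le> b powr h * fibre_sup \<Lambda> f D (s + h) n"
    using fibre_sum_le_sup[OF y] by (intro mult_left_mono) auto
  finally show "fibre_sum \<Lambda> f D s n y \<le> b powr h * fibre_sup \<Lambda> f D (s + h) n" .
qed

end

section \<open>Orbits that stay close\<close>

context conformal_map
begin

text \<open>
  The distortion of \<open>f\<^sup>n\<close> along nearby orbits: one factor from \<open>deriv_distortion\<close> per step.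
  The bound grows with \<open>n\<close>, but at the arbitrarily small rate \<open>2 * \<epsilon>\<close>.
\<close>
lemma shadow_deriv:
  assumes ac: "almost_conformal \<Lambda> f D \<epsilon> r" and "\<epsilon> > 0" and "x \<in> \<Lambda>" "u \<in> \<Lambda>"
    and "\<And>k. k < n \<Longrightarrow> dist ((f ^^ k) x) ((f ^^ k) u) < r"
  shows "exp (- (2 * \<epsilon> * n)) * deriv_prod f D n x \<le> deriv_prod f D n u"
  using assms(5)
proof (induction n)
  case (Suc n)
  let ?x = "(f ^^ n) x" and ?u = "(f ^^ n) u"
  have mem: "?x \<in> \<Lambda>" "?u \<in> \<Lambda>" using assms funpow_in by auto
  have "exp (- (2 * \<epsilon> * Suc n)) * deriv_prod f D (Suc n) x
      = (exp (- (2 * \<epsilon> * n)) * deriv_prod f D n x) * (exp (- (2 * \<epsilon>)) * D ?x)"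
    by (simp add: deriv_prod_Suc algebra_simps flip: exp_add)
  also have "\<dots> \<le> deriv_prod f D n u * D ?u"
    using Suc.IH Suc.prems deriv_distortion[OF ac assms(2) mem] deriv_prod_pos[OF assms(4), of n]
      pos[OF mem(1)]
    by (intro mult_mono) auto
  finally show ?case by (simp add: deriv_prod_Suc)
qed simp

lemma shadow_expand:
  assumes ac: "almost_conformal \<Lambda> f D \<epsilon> r" and "u \<in> \<Lambda>" "v \<in> \<Lambda>"
    and "\<And>k. k < n \<Longrightarrow> dist ((f ^^ k) u) ((f ^^ k) v) < r"
  shows "exp (- (\<epsilon> * n)) * deriv_prod f D n u * dist u v \<le> dist ((f ^^ n) u) ((f ^^ n) v)"
  using assms(4)
proof (induction n)
  case (Suc n)
  let ?u = "(f ^^ n) u" and ?v = "(f ^^ n) v"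
  have mem: "?u \<in> \<Lambda>" "?v \<in> \<Lambda>" using assms funpow_in by auto
  have "exp (- (\<epsilon> * Suc n)) * deriv_prod f D (Suc n) u * dist u v
      = exp (- \<epsilon>) * D ?u * (exp (- (\<epsilon> * n)) * deriv_prod f D n u * dist u v)"
    by (simp add: deriv_prod_Suc algebra_simps flip: exp_add)
  also have "\<dots> \<le> exp (- \<epsilon>) * D ?u * dist ?u ?v"
    using Suc pos[OF mem(1)] by (intro mult_left_mono) auto
  also have "\<dots> \<le> dist (f ?u) (f ?v)"
    using Suc.prems by (intro almost_conformalD(1)[OF ac mem]) simp
  finally show ?case by simp
qed simp

text \<open>
  An open map covers a ball about each image point; compactness makes the radius
  independent of the point.
\<close>
lemma uniformly_open:
  assumes "r > 0"
  obtains r0 where "r0 > 0"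
    "\<And>x w. x \<in> \<Lambda> \<Longrightarrow> w \<in> \<Lambda> \<Longrightarrow> dist (f x) w < r0 \<Longrightarrow> \<exists>u\<in>\<Lambda>. dist x u < r \<and> f u = w"
proof -
  have "\<exists>d>0. \<exists>e>0. d \<le> r / 2 \<and>
          (\<forall>x'\<in>\<Lambda>. dist x x' < d \<longrightarrow> dist (f x) (f x') < e / 2) \<and>
          (\<forall>w\<in>\<Lambda>. dist (f x) w < e \<longrightarrow> (\<exists>u\<in>\<Lambda>. dist x u < r / 2 \<and> f u = w))"
    if x: "x \<in> \<Lambda>" for x
  proof -
    have "openin (top_of_set \<Lambda>) (\<Lambda> \<inter> ball x (r / 2))" by (simp add: openin_open_Int)
    then have "openin (top_of_set \<Lambda>) (f ` (\<Lambda> \<inter> ball x (r / 2)))"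
      using open_f by (simp add: open_map_def)
    moreover have "f x \<in> f ` (\<Lambda> \<inter> ball x (r / 2))" using x assms by auto
    ultimately obtain e where e: "e > 0" "ball (f x) e \<inter> \<Lambda> \<subseteq> f ` (\<Lambda> \<inter> ball x (r / 2))"
      unfolding openin_contains_ball by blast
    obtain d where d: "d > 0" "\<forall>x'\<in>\<Lambda>. dist x' x < d \<longrightarrow> dist (f x') (f x) < e / 2"
      using cont x e(1) unfolding continuous_on_iff by (meson half_gt_zero)
    have "\<exists>u\<in>\<Lambda>. dist x u < r / 2 \<and> f u = w" if "w \<in> \<Lambda>" "dist (f x) w < e" for w
    proof -
      have "w \<in> f ` (\<Lambda> \<inter> ball x (r / 2))" using e(2) that by auto
      then show ?thesis by auto
    qed
    then show ?thesis
      using d e(1) assms by (intro exI[of _ "min d (r/2)"] conjI exI[of _ e]) (auto simp: dist_commute)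
  qed
  then obtain d e where de: "\<And>x. x \<in> \<Lambda> \<Longrightarrow> d x > 0 \<and> e x > 0 \<and> d x \<le> r / 2 \<and>
          (\<forall>x'\<in>\<Lambda>. dist x x' < d x \<longrightarrow> dist (f x) (f x') < e x / 2) \<and>
          (\<forall>w\<in>\<Lambda>. dist (f x) w < e x \<longrightarrow> (\<exists>u\<in>\<Lambda>. dist x u < r / 2 \<and> f u = w))"
    by metis
  obtain F where F: "F \<subseteq> \<Lambda>" "finite F" "\<Lambda> \<subseteq> (\<Union>x\<in>F. ball x (d x))"
    by (rule compactE_image[OF compact, of \<Lambda> "\<lambda>x. ball x (d x)"]) (use de in auto)
  have F0: "F \<noteq> {}" using F(3) nonempty by auto
  define r0 where "r0 = Min ((\<lambda>x. e x / 2) ` F)"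
  have "r0 > 0" unfolding r0_def using F F0 de by (subst Min_gr_iff) (auto simp: subset_iff)
  moreover have "\<exists>u\<in>\<Lambda>. dist x' u < r \<and> f u = w"
    if xw: "x' \<in> \<Lambda>" "w \<in> \<Lambda>" "dist (f x') w < r0" for x' w
  proof -
    obtain x where x: "x \<in> F" "dist x x' < d x" using F(3) xw(1) by (auto simp: subset_iff)
    then have xL: "x \<in> \<Lambda>" using F(1) by blast
    have "r0 \<le> e x / 2" unfolding r0_def using F(2) x(1) by (intro Min_le) auto
    moreover have "dist (f x) (f x') < e x / 2" using de[OF xL] xw(1) x(2) by blast
    ultimately have "dist (f x) w < e x"
      using xw(3) dist_triangle[of "f x" w "f x'"] by simp
    then obtain u where u: "u \<in> \<Lambda>" "dist x u < r / 2" "f u = w" using de[OF xL] xw(2) by blast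
    have "dist x' u < r"
      using dist_triangle[of x' u x] x(2) u(2) de[OF xL] by (simp add: dist_commute)
    with u show ?thesis by blast
  qed
  ultimately show thesis using that by blast
qed

end

section \<open>Covers of small Hausdorff content bound the fibre sums\<close>

text \<open>
  Expansion in a single step holds for a sufficiently high iterate of a uniformly expanding map.
\<close>
locale expanding_conformal_map = conformal_map +
  fixes lam :: real
  assumes lam: "lam > 1" and expanding: "\<And>x. x \<in> \<Lambda> \<Longrightarrow> lam \<le> D x"
begin

lemma deriv_prod_ge_power: "x \<in> \<Lambda> \<Longrightarrow> lam ^ n \<le> deriv_prod f D n x"
proof (induction n)
  case (Suc n)
  then show ?case using expanding[OF funpow_in, of x n] lam deriv_prod_pos[of x n]
    by (simp add: deriv_prod_Suc mult.commute[of lam]) (intro mult_mono, auto)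
qed simp

lemma deriv_prod_mono:
  assumes "x \<in> \<Lambda>" "k \<le> n" shows "deriv_prod f D k x \<le> deriv_prod f D n x"
proof -
  have "1 \<le> lam ^ (n - k)" using lam by (simp add: one_le_power)
  also have "\<dots> \<le> deriv_prod f D (n - k) ((f ^^ k) x)"
    using assms(1) by (intro deriv_prod_ge_power funpow_in)
  finally show ?thesis
    using deriv_prod_add[of f D k "n - k" x] assms deriv_prod_pos[of x k] by simp
qed

text \<open>
  The right-hand side bounds the size of the images of the ball at all times up to \<open>n\<close>,
  because derivatives along an orbit increase with time.  As long as it stays below the scale
  of almost conformality, the next step is controlled.
\<close>
lemma ball_orbit_bound:
  assumes ac: "almost_conformal \<Lambda> f D \<epsilon> r" and "\<epsilon> > 0" and x: "x \<in> \<Lambda>" and u: "u \<in> \<Lambda>"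
    and "dist x u < \<rho>" and small: "exp (\<epsilon> * n) * deriv_prod f D n x * \<rho> \<le> r" and "k \<le> n"
  shows "dist ((f ^^ k) x) ((f ^^ k) u) < exp (\<epsilon> * n) * deriv_prod f D n x * \<rho>"
proof -
  have \<rho>: "\<rho> > 0" using assms(5) by (metis dist_not_less_zero linorder_not_less order_le_less_trans)
  have mono: "exp (\<epsilon> * k) * deriv_prod f D k x * \<rho> \<le> exp (\<epsilon> * n) * deriv_prod f D n x * \<rho>"
    if "k \<le> n" for k
    using that assms(2) \<rho> deriv_prod_pos[OF x, of k] deriv_prod_mono[OF x that]
    by (intro mult_right_mono mult_mono) auto
  have "dist ((f ^^ k) x) ((f ^^ k) u) < exp (\<epsilon> * k) * deriv_prod f D k x * \<rho>"
    using \<open>k \<le> n\<close>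
  proof (induction k)
    case 0
    then show ?case using assms(5) by simp
  next
    case (Suc k)
    let ?x = "(f ^^ k) x" and ?u = "(f ^^ k) u"
    have mem: "?x \<in> \<Lambda>" "?u \<in> \<Lambda>" using x u funpow_in by auto
    have IH: "dist ?x ?u < exp (\<epsilon> * k) * deriv_prod f D k x * \<rho>" using Suc by simp
    then have "dist ?x ?u < r" using mono[of k] small Suc.prems by simp
    then have "dist (f ?x) (f ?u) \<le> exp \<epsilon> * D ?x * dist ?x ?u"
      using almost_conformalD(2)[OF ac mem] by simp
    also have "\<dots> < exp \<epsilon> * D ?x * (exp (\<epsilon> * k) * deriv_prod f D k x * \<rho>)"
      using IH pos[OF mem(1)] by (intro mult_strict_left_mono) auto
    also have "\<dots> = exp (\<epsilon> * Suc k) * deriv_prod f D (Suc k) x * \<rho>"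
      by (simp add: deriv_prod_Suc algebra_simps exp_add)
    finally show ?case by simp
  qed
  with mono[OF assms(7)] show ?thesis by simp
qed

text \<open>
  Iterate a small ball to the last time \<open>n\<close> at which its image is still smaller than a fixed
  radius \<open>R\<close>.  The derivative at that time is comparable to \<open>R / \<rho>\<close> up to a distortion
  \<open>exp (3 * \<epsilon> * n)\<close>.  Since \<open>n\<close> is at most logarithmic in \<open>R / \<rho>\<close>, the distortion is paid for
  by replacing the exponent \<open>s\<close> of \<open>\<rho>\<close> by the smaller exponent \<open>t\<close>.
\<close>
lemma ball_escape_time:
  assumes t: "0 \<le> t" "t < s"
  obtains K \<delta> where "K > 0" "\<delta> > 0"
    and "\<And>x \<rho>. x \<in> \<Lambda> \<Longrightarrow> 0 < \<rho> \<Longrightarrow> \<rho> < \<delta> \<Longrightarrow>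
      \<exists>n\<ge>1. (\<forall>u\<in>\<Lambda> \<inter> ball x \<rho>. deriv_prod f D n u powr (- s) \<le> K * \<rho> powr t) \<and>
        inj_on (f ^^ n) (\<Lambda> \<inter> ball x \<rho>)"
proof -
  \<comment> \<open>With this choice \<open>exp (3 * \<epsilon> * s * n)\<close> is exactly \<open>(lam ^ n) powr (s - t)\<close>.\<close>
  define \<epsilon> where "\<epsilon> = (s - t) * ln lam / (3 * s)"
  have \<epsilon>: "\<epsilon> > 0" using t lam by (simp add: \<epsilon>_def)
  have \<epsilon>s: "3 * \<epsilon> * s = (s - t) * ln lam" using t by (simp add: \<epsilon>_def)
  obtain r where r: "r > 0" and ac: "almost_conformal \<Lambda> f D \<epsilon> r" using conformal[OF \<epsilon>] by blast
  define R where "R = r / 2"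
  have R: "R > 0" using r by (simp add: R_def)
  obtain M where M: "\<forall>x\<in>\<Lambda>. D x \<le> M" using bounded_above by blast
  have M0: "M > 0" using M nonempty pos by (meson ex_in_conv less_le_trans)
  \<comment> \<open>One step enlarges the bound \<open>q\<close> below by at most the factor \<open>exp \<epsilon> * M\<close>, so balls of radius
    less than \<open>\<delta>\<close> survive the first step, and at the last time the bound is at least \<open>\<delta>\<close>.\<close>
  define \<delta> where "\<delta> = R / (exp \<epsilon> * M)"
  have \<delta>: "\<delta> > 0" using R M0 by (simp add: \<delta>_def)
  define K where "K = \<delta> powr (- s) * R powr (s - t)"
  have K: "K > 0" using \<delta> R by (simp add: K_def)
  have "\<exists>n\<ge>1. (\<forall>u\<in>\<Lambda> \<inter> ball x \<rho>. deriv_prod f D n u powr (- s) \<le> K * \<rho> powr t) \<and>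
        inj_on (f ^^ n) (\<Lambda> \<inter> ball x \<rho>)"
    if x: "x \<in> \<Lambda>" and \<rho>: "0 < \<rho>" "\<rho> < \<delta>" for x \<rho>
  proof -
    define q where "q n = exp (\<epsilon> * real n) * deriv_prod f D n x * \<rho>" for n
    have q_ge: "lam ^ n * \<rho> \<le> q n" for n
    proof -
      have "1 * lam ^ n \<le> exp (\<epsilon> * n) * deriv_prod f D n x"
        using deriv_prod_ge_power[OF x] \<epsilon> lam by (intro mult_mono) auto
      then show ?thesis using \<rho> by (simp add: q_def)
    qed
    have q_Suc: "q (Suc n) \<le> (exp \<epsilon> * M) * q n" for n
    proof -
      have "q (Suc n) = exp \<epsilon> * D ((f ^^ n) x) * q n"
        by (simp add: q_def deriv_prod_Suc algebra_simps exp_add)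
      moreover have "D ((f ^^ n) x) \<le> M" using M funpow_in[OF x] by blast
      moreover have "q n \<ge> 0" using \<rho> deriv_prod_pos[OF x, of n] by (simp add: q_def)
      ultimately show ?thesis by (simp add: mult_right_mono)
    qed
    obtain N where "R / \<rho> < lam ^ N" using lam real_arch_pow by blast
    then have "R \<le> q N" using q_ge[of N] \<rho> by (simp add: field_simps)
    then have ex: "\<exists>m. R \<le> q m" by blast
    define m where "m = (LEAST m. R \<le> q m)"
    have m: "R \<le> q m" unfolding m_def using ex by (rule LeastI_ex)
    have below: "q k < R" if "k < m" for k
      using not_less_Least[of k "\<lambda>m. R \<le> q m"] that unfolding m_def by simp
    have "q 0 < \<delta>" using \<rho> by (simp add: q_def)
    have "q 1 < R"
      using q_Suc[of 0] \<open>q 0 < \<delta>\<close> M0 by (simp add: \<delta>_def field_simps)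
    have "\<delta> < R"
    proof -
      have "lam \<le> M" using M expanding nonempty by (meson ex_in_conv order_trans)
      then have "1 * 1 < exp \<epsilon> * M" using \<epsilon> lam by (intro mult_strict_mono) auto
      then show ?thesis using R by (simp add: \<delta>_def field_simps)
    qed
    have "m \<noteq> 0" using m \<open>q 0 < \<delta>\<close> \<open>\<delta> < R\<close> by (intro notI) simp
    moreover have "m \<noteq> 1" using m \<open>q 1 < R\<close> by (intro notI) simp
    ultimately
    obtain n where n: "m = Suc n" "n \<ge> 1" by (cases m) auto
    have qn: "q n < R" using below n by simp
    have "R \<le> (exp \<epsilon> * M) * q n" using m q_Suc[of n] n by simp
    then have qn': "\<delta> \<le> q n" using M0 by (simp add: \<delta>_def field_simps)
    have orbit: "dist ((f ^^ k) x) ((f ^^ k) u) < R" if "u \<in> \<Lambda> \<inter> ball x \<rho>" "k \<le> n" for u k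
    proof -
      have "dist ((f ^^ k) x) ((f ^^ k) u) < q n" unfolding q_def
        using that qn r by (intro ball_orbit_bound[OF ac \<epsilon> x]) (auto simp: q_def R_def)
      then show ?thesis using qn by simp
    qed
    have "deriv_prod f D n u powr (- s) \<le> K * \<rho> powr t" if u: "u \<in> \<Lambda> \<inter> ball x \<rho>" for u
    proof -
      have "exp (- (2 * \<epsilon> * n)) * deriv_prod f D n x \<le> deriv_prod f D n u"
      proof (rule shadow_deriv[OF ac \<epsilon> x])
        fix k assume "k < n"
        then show "dist ((f ^^ k) x) ((f ^^ k) u) < r" using orbit[OF u, of k] r by (simp add: R_def)
      qed (use u in simp)
      moreover have "exp (- (\<epsilon> * n)) * \<delta> / \<rho> \<le> deriv_prod f D n x"
        using qn' \<rho> by (simp add: q_def field_simps exp_minus)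
      then have "exp (- (2 * \<epsilon> * n)) * (exp (- (\<epsilon> * n)) * \<delta> / \<rho>)
          \<le> exp (- (2 * \<epsilon> * n)) * deriv_prod f D n x" by (rule mult_left_mono) simp
      ultimately have "exp (- (2 * \<epsilon> * n)) * (exp (- (\<epsilon> * n)) * \<delta> / \<rho>) \<le> deriv_prod f D n u"
        by simp
      then have "exp (- (3 * \<epsilon> * n)) * \<delta> / \<rho> \<le> deriv_prod f D n u"
        by (simp flip: exp_add add: algebra_simps)
      then have "deriv_prod f D n u powr (- s) \<le> (exp (- (3 * \<epsilon> * n)) * \<delta> / \<rho>) powr (- s)"
        using t \<delta> \<rho> by (intro powr_mono2') auto
      also have "\<dots> = exp (3 * \<epsilon> * s * n) * \<delta> powr (- s) * \<rho> powr s"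
      proof -
        have "(e * \<delta> / \<rho>) powr (- s) = e powr (- s) * \<delta> powr (- s) * \<rho> powr s" if "e > 0" for e
          using that \<delta> \<rho> by (simp add: powr_divide powr_mult powr_minus field_simps)
        moreover have "exp (- (3 * \<epsilon> * n)) powr (- s) = exp (3 * \<epsilon> * s * n)"
          by (simp add: exp_powr_real mult_ac)
        ultimately show ?thesis by simp
      qed
      also have "exp (3 * \<epsilon> * s * n) * \<delta> powr (- s) * \<rho> powr s = exp (3 * \<epsilon> * s * n) * \<rho> powr (s - t) * (\<delta> powr (- s) * \<rho> powr t)"
        using \<rho> by (simp add: powr_diff)
      also have "\<dots> \<le> R powr (s - t) * (\<delta> powr (- s) * \<rho> powr t)"
      proof (rule mult_right_mono)
        have "lam ^ n * \<rho> \<le> R" using q_ge[of n] qn by simp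
        then have "(lam ^ n * \<rho>) powr (s - t) \<le> R powr (s - t)"
          using t \<rho> lam by (intro powr_mono2) auto
        moreover have "(lam ^ n) powr (s - t) = exp (3 * \<epsilon> * s * n)"
          unfolding \<epsilon>s using lam by (simp add: powr_def ln_realpow)
        ultimately show "exp (3 * \<epsilon> * s * n) * \<rho> powr (s - t) \<le> R powr (s - t)"
          using lam \<rho> by (simp add: powr_mult)
      qed simp
      finally show ?thesis by (simp add: K_def mult_ac)
    qed
    moreover have "inj_on (f ^^ n) (\<Lambda> \<inter> ball x \<rho>)"
    proof (rule inj_onI)
      fix u v assume u: "u \<in> \<Lambda> \<inter> ball x \<rho>" and v: "v \<in> \<Lambda> \<inter> ball x \<rho>" and eq: "(f ^^ n) u = (f ^^ n) v"
      have "dist ((f ^^ k) u) ((f ^^ k) v) < r" if "k < n" for k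
        using orbit[OF u, of k] orbit[OF v, of k] that
          dist_triangle3[of "(f ^^ k) u" "(f ^^ k) v" "(f ^^ k) x"] by (simp add: R_def)
      then have "exp (- (\<epsilon> * n)) * deriv_prod f D n u * dist u v \<le> 0"
        using shadow_expand[OF ac, of u v n] u v eq by simp
      then show "u = v" using deriv_prod_pos[of u n] u
        by (simp add: mult_le_0_iff zero_less_mult_iff not_less[symmetric])
    qed
    ultimately show ?thesis using n(2) by blast
  qed
  with K \<delta> that show thesis by blast
qed

text \<open>
  A renewal inequality.  Each point of a fibre of \<open>f\<^sup>N\<close> is assigned to one ball of the cover; applying
  \<open>f\<^sup>n\<close>, with the escape time \<open>n\<close> of that ball, maps the points of the ball injectively
  into a fibre of \<open>f\<^bsup>N - n\<^esup>\<close>.  If the weights of the balls add up to at most \<open>1\<close>, the maximum over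
  the first values is never exceeded; \<open>n \<ge> 1\<close> is what makes the induction progress.
\<close>
lemma fibre_sup_bounded_of_covers:
  assumes t: "0 \<le> t" "t < s"
    and covers: "\<And>\<delta> \<eta>. \<delta> > 0 \<Longrightarrow> \<eta> > 0 \<Longrightarrow> \<exists>F :: ('a \<times> real) set. finite F \<and>
      (\<forall>(x, \<rho>)\<in>F. x \<in> \<Lambda> \<and> 0 < \<rho> \<and> \<rho> < \<delta>) \<and> \<Lambda> \<subseteq> (\<Union>(x, \<rho>)\<in>F. ball x \<rho>) \<and>
      (\<Sum>(x, \<rho>)\<in>F. \<rho> powr t) \<le> \<eta>"
  shows "\<exists>B. \<forall>N. fibre_sup \<Lambda> f D s N \<le> B"
proof -
  obtain K \<delta> where K: "K > 0" and \<delta>: "\<delta> > 0"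
    and w: "\<And>x \<rho>. x \<in> \<Lambda> \<Longrightarrow> 0 < \<rho> \<Longrightarrow> \<rho> < \<delta> \<Longrightarrow>
      \<exists>n\<ge>1. (\<forall>u\<in>\<Lambda> \<inter> ball x \<rho>. deriv_prod f D n u powr (- s) \<le> K * \<rho> powr t) \<and>
        inj_on (f ^^ n) (\<Lambda> \<inter> ball x \<rho>)"
    using ball_escape_time[OF t] by metis
  obtain F :: "('a \<times> real) set" where F: "finite F"
    "\<forall>(x, \<rho>)\<in>F. x \<in> \<Lambda> \<and> 0 < \<rho> \<and> \<rho> < \<delta>" "\<Lambda> \<subseteq> (\<Union>(x, \<rho>)\<in>F. ball x \<rho>)"
    "(\<Sum>(x, \<rho>)\<in>F. \<rho> powr t) \<le> 1 / K"
    using covers[OF \<delta>, of "1 / K"] K by auto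
  define b where "b i = \<Lambda> \<inter> ball (fst i) (snd i)" for i :: "'a \<times> real"
  have "\<forall>i\<in>F. \<exists>n\<ge>1. (\<forall>u\<in>b i. deriv_prod f D n u powr (- s) \<le> K * snd i powr t) \<and>
        inj_on (f ^^ n) (b i)"
    using w F(2) unfolding b_def by (auto simp: case_prod_beta)
  then obtain n where n: "\<And>i. i \<in> F \<Longrightarrow> n i \<ge> 1"
    "\<And>i u. i \<in> F \<Longrightarrow> u \<in> b i \<Longrightarrow> deriv_prod f D (n i) u powr (- s) \<le> K * snd i powr t"
    "\<And>i. i \<in> F \<Longrightarrow> inj_on (f ^^ n i) (b i)"
    by metis
  have "\<forall>x\<in>\<Lambda>. \<exists>i\<in>F. x \<in> b i" using F(3) by (force simp: b_def subset_iff split_beta)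
  then obtain c where c: "\<And>x. x \<in> \<Lambda> \<Longrightarrow> c x \<in> F \<and> x \<in> b (c x)" by metis
  define L where "L = Max (n ` F)"
  have nL: "n i \<le> L" if "i \<in> F" for i unfolding L_def using that F(1) by simp
  define B where "B = Max (fibre_sup \<Lambda> f D s ` {..L})"
  have "fibre_sup \<Lambda> f D s N \<le> B" for N
  proof (induction N rule: less_induct)
    case (less N)
    show ?case
    proof (cases "N \<le> L")
      case True
      then show ?thesis unfolding B_def by (intro Max_ge) auto
    next
      case False
      have B0: "B \<ge> 0"
        using fibre_sup_pos[of s 0] unfolding B_def by (meson Max_ge atMost_iff finite_atMost finite_imageI image_eqI le0 less_imp_le order_trans)
      show ?thesis
      proof (rule fibre_sup_le)
        fix y assume y: "y \<in> \<Lambda>"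
        let ?g = "\<lambda>x. deriv_prod f D N x powr (- s)"
        have piece: "sum ?g {x \<in> fibre \<Lambda> f N y. c x = i} \<le> K * snd i powr t * B" if i: "i \<in> F" for i
        proof -
          let ?A = "{x \<in> fibre \<Lambda> f N y. c x = i}" and ?m = "N - n i"
          have m: "n i + ?m = N" "?m < N" using nL[OF i] n(1)[OF i] False by auto
          have A: "?A \<subseteq> b i" using c by (auto simp: fibre_def)
          have "sum ?g ?A \<le> (\<Sum>x\<in>?A. K * snd i powr t * deriv_prod f D ?m ((f ^^ n i) x) powr (- s))"
          proof (rule sum_mono)
            fix x assume x: "x \<in> ?A"
            then have xL: "x \<in> \<Lambda>" by (simp add: fibre_def)
            have "?g x = deriv_prod f D (n i) x powr (- s) * deriv_prod f D ?m ((f ^^ n i) x) powr (- s)"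
              using deriv_prod_add[of f D "n i" ?m x] m deriv_prod_pos[OF xL, of "n i"]
                deriv_prod_pos[OF funpow_in[OF xL], of ?m "n i"] by (simp add: powr_mult)
            also have "\<dots> \<le> K * snd i powr t * deriv_prod f D ?m ((f ^^ n i) x) powr (- s)"
              using n(2)[OF i] x A by (intro mult_right_mono) auto
            finally show "?g x \<le> K * snd i powr t * deriv_prod f D ?m ((f ^^ n i) x) powr (- s)" .
          qed
          also have "\<dots> = K * snd i powr t * (\<Sum>z\<in>(f ^^ n i) ` ?A. deriv_prod f D ?m z powr (- s))"
            using inj_on_subset[OF n(3)[OF i] A]
            by (simp add: sum.reindex sum_distrib_left)
          also have "\<dots> \<le> K * snd i powr t * fibre_sum \<Lambda> f D s ?m y"
          proof (rule mult_left_mono)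
            have "(f ^^ ?m) ((f ^^ n i) x) = (f ^^ N) x" for x
              using m(1) funpow_add[of ?m "n i" f] by (simp add: add.commute)
            then have "(f ^^ n i) ` ?A \<subseteq> fibre \<Lambda> f ?m y"
              using funpow_in by (auto simp: fibre_def)
            then show "(\<Sum>z\<in>(f ^^ n i) ` ?A. deriv_prod f D ?m z powr (- s)) \<le> fibre_sum \<Lambda> f D s ?m y"
              unfolding fibre_sum_def by (intro sum_mono2 finite_fibre) auto
          qed (use K in simp)
          also have "\<dots> \<le> K * snd i powr t * B"
            using fibre_sum_le_sup[OF y, of s ?m] less.IH[OF m(2)] K by (intro mult_left_mono) auto
          finally show ?thesis .
        qed
        have "fibre_sum \<Lambda> f D s N y = (\<Sum>i\<in>F. sum ?g {x \<in> fibre \<Lambda> f N y. c x = i})"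
          unfolding fibre_sum_def
          using c by (intro sum.group[symmetric] finite_fibre F(1)) (auto simp: fibre_def)
        also have "\<dots> \<le> (\<Sum>i\<in>F. K * snd i powr t * B)" by (intro sum_mono piece)
        also have "\<dots> = (K * (\<Sum>(x, \<rho>)\<in>F. \<rho> powr t)) * B"
          by (simp add: sum_distrib_left sum_distrib_right case_prod_beta)
        also have "\<dots> \<le> 1 * B"
          using F(4) K B0 by (intro mult_right_mono) (auto simp: field_simps)
        finally show "fibre_sum \<Lambda> f D s N y \<le> B" by simp
      qed
    qed
  qed
  then show ?thesis by blast
qed

end

section \<open>Small fibre sums bound the covering numbers\<close>

lemma (in conformal_map) has_cover_exists:
  assumes "\<delta> > 0" shows "\<exists>k. has_cover \<Lambda> \<delta> k"
proof -
  obtain F where F: "finite F" "F \<subseteq> \<Lambda>" "\<Lambda> \<subseteq> (\<Union>x\<in>F. ball x (\<delta> / 2))"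
    using finite_net[of "\<delta> / 2"] assms by auto
  have "dist u v \<le> \<delta>" if "u \<in> ball x (\<delta> / 2)" "v \<in> ball x (\<delta> / 2)" for u v x
    using that dist_triangle3[of u v x] by simp
  then have "has_cover \<Lambda> \<delta> (card ((\<lambda>x. ball x (\<delta> / 2)) ` F))"
    using F by (intro has_coverI[of "(\<lambda>x. ball x (\<delta> / 2)) ` F"]) auto
  then show ?thesis by blast
qed

context expanding_conformal_map
begin

text \<open>
  Lifting a point through \<open>n\<close> steps, starting from the end of the orbit: openness provides the
  preimage, and expansion keeps it within the distance of the point that it maps to, so the same \<open>r0\<close>
  works for every \<open>n\<close>.
\<close>
lemma pull_back_orbit:
  assumes "r > 0"
  obtains r0 where "0 < r0" "r0 \<le> r"
    "\<And>n x w. x \<in> \<Lambda> \<Longrightarrow> w \<in> \<Lambda> \<Longrightarrow> dist ((f ^^ n) x) w < r0 \<Longrightarrow>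
      \<exists>u\<in>\<Lambda>. (f ^^ n) u = w \<and> (\<forall>k\<le>n. dist ((f ^^ k) x) ((f ^^ k) u) < r0)"
proof -
  have "ln lam > 0" using lam by simp
  then obtain r' where r': "r' > 0" and ac: "almost_conformal \<Lambda> f D (ln lam) r'"
    using conformal by blast
  obtain r1 where r1: "r1 > 0"
    "\<And>x w. x \<in> \<Lambda> \<Longrightarrow> w \<in> \<Lambda> \<Longrightarrow> dist (f x) w < r1 \<Longrightarrow> \<exists>u\<in>\<Lambda>. dist x u < r' \<and> f u = w"
    using uniformly_open[OF r'] by metis
  define r0 where "r0 = min r r1"
  have one: "\<exists>u\<in>\<Lambda>. dist x u < r0 \<and> f u = w"
    if xw: "x \<in> \<Lambda>" "w \<in> \<Lambda>" "dist (f x) w < r0" for x w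
  proof -
    have "dist (f x) w < r1" using xw(3) by (simp add: r0_def)
    then obtain u where u: "u \<in> \<Lambda>" "dist x u < r'" "f u = w" using r1(2) xw by blast
    have "1 * dist x u \<le> exp (- ln lam) * D x * dist x u"
    proof (rule mult_right_mono)
      have "lam / lam \<le> D x / lam" using expanding[OF xw(1)] lam by (intro divide_right_mono) auto
      then show "1 \<le> exp (- ln lam) * D x" using lam by (simp add: exp_minus field_simps)
    qed simp
    also have "\<dots> \<le> dist (f x) w" using almost_conformalD(1)[OF ac xw(1) u(1,2)] u(3) by simp
    finally have "dist x u < r0" using xw(3) by simp
    with u show ?thesis by blast
  qed
  have "\<exists>u\<in>\<Lambda>. (f ^^ n) u = w \<and> (\<forall>k\<le>n. dist ((f ^^ k) x) ((f ^^ k) u) < r0)"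
    if x: "x \<in> \<Lambda>" and "w \<in> \<Lambda>" "dist ((f ^^ n) x) w < r0" for n x w
    using that(2,3)
  proof (induction n arbitrary: w)
    case 0
    then show ?case by (intro bexI[of _ w]) auto
  next
    case (Suc n)
    then obtain w' where w': "w' \<in> \<Lambda>" "dist ((f ^^ n) x) w' < r0" "f w' = w"
      using one[OF funpow_in[OF x, of n] Suc.prems(1)] by auto
    obtain u where "u \<in> \<Lambda>" "(f ^^ n) u = w'" "\<forall>k\<le>n. dist ((f ^^ k) x) ((f ^^ k) u) < r0"
      using Suc.IH[OF w'(1,2)] by blast
    with w'(3) Suc.prems show ?case by (intro bexI[of _ u]) (auto simp: le_Suc_eq)
  qed
  with assms r1(1) show thesis by (intro that[of r0]) (auto simp: r0_def)
qed

text \<open>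
  The index set consists of the pairs \<open>(y, x)\<close> with \<open>y\<close> in a finite net and \<open>x\<close> in the \<open>n\<close>-fold
  fibre over \<open>y\<close>.  Lifting \<open>y\<close> along the orbit of an arbitrary point \<open>u\<close> shows that \<open>u\<close> follows the
  orbit of one of these \<open>x\<close>, and on the set of followers \<open>f\<^sup>n\<close> expands distances at least
  by the factor \<open>c (y, x)\<close>.  The size of the net depends on \<open>\<epsilon>\<close> but not on \<open>n\<close>, so it is outweighed by
  the exponential decay of the fibre sums.
\<close>
lemma cover_refinement:
  assumes "t \<ge> 0" and small: "fibre_sup \<Lambda> f D t 1 < 1"
  shows "\<exists>(I :: ('a \<times> 'a) set) c. finite I \<and> (\<forall>i\<in>I. c i > 1) \<and> (\<Sum>i\<in>I. c i powr (- t)) \<le> 1 \<and>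
    (\<forall>\<delta> k. (\<forall>i\<in>I. has_cover \<Lambda> (c i * \<delta>) (k i)) \<longrightarrow> has_cover \<Lambda> \<delta> (\<Sum>i\<in>I. k i))"
proof -
  define a where "a = fibre_sup \<Lambda> f D t 1"
  have a: "0 < a" "a < 1" using small fibre_sup_pos by (auto simp: a_def)
  \<comment> \<open>The first bound keeps the factors \<open>c\<close> above \<open>1\<close>, the second keeps the base \<open>b\<close> of the
    exponential decay below \<open>1\<close>; both tolerate the total distortion \<open>exp (3 * \<epsilon>)\<close> per step.\<close>
  define \<epsilon> where "\<epsilon> = min (ln lam / 4) (- ln a / (3 * (t + 1)))"
  have "- ln a / (3 * (t + 1)) > 0" using a assms(1) by (intro divide_pos_pos) auto
  then have \<epsilon>: "\<epsilon> > 0" using lam by (simp add: \<epsilon>_def)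
  have "\<epsilon> \<le> ln lam / 4" unfolding \<epsilon>_def by (rule min.cobounded1)
  moreover have "ln lam > 0" using lam by simp
  ultimately have \<epsilon>_lam: "3 * \<epsilon> < ln lam" by linarith
  have "3 * \<epsilon> * (t + 1) \<le> - ln a"
  proof -
    have "\<epsilon> \<le> - ln a / (3 * (t + 1))" by (simp add: \<epsilon>_def)
    then show ?thesis using assms by (simp add: field_simps)
  qed
  then have \<epsilon>_a: "3 * \<epsilon> * t < - ln a" using \<epsilon> by (simp add: algebra_simps)
  define b where "b = exp (3 * \<epsilon> * t) * a"
  have b: "0 < b" "b < 1"
  proof -
    have "exp (3 * \<epsilon> * t) < exp (- ln a)" using \<epsilon>_a by simp
    then show "b < 1" using a by (simp add: b_def exp_minus field_simps)
  qed (simp add: b_def a)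
  obtain r where r: "r > 0" and ac: "almost_conformal \<Lambda> f D \<epsilon> r" using conformal[OF \<epsilon>] by blast
  obtain r0 where r0: "0 < r0" "r0 \<le> r / 2"
    "\<And>n x w. x \<in> \<Lambda> \<Longrightarrow> w \<in> \<Lambda> \<Longrightarrow> dist ((f ^^ n) x) w < r0 \<Longrightarrow>
      \<exists>u\<in>\<Lambda>. (f ^^ n) u = w \<and> (\<forall>k\<le>n. dist ((f ^^ k) x) ((f ^^ k) u) < r0)"
    by (rule pull_back_orbit[of "r / 2"]) (use r in \<open>simp, metis\<close>)
  obtain Y where Y: "finite Y" "Y \<subseteq> \<Lambda>" "\<Lambda> \<subseteq> (\<Union>y\<in>Y. ball y r0)" using finite_net[OF r0(1)] by metis
  have "(\<lambda>n. real (card Y) * b ^ n) \<longlonglongrightarrow> real (card Y) * 0"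
    using b by (intro tendsto_intros LIMSEQ_power_zero) auto
  then have "eventually (\<lambda>n. card Y * b ^ n < 1) sequentially" by (simp add: order_tendsto_iff)
  then have "eventually (\<lambda>n. card Y * b ^ n < 1 \<and> n \<ge> 1) sequentially"
    using eventually_ge_at_top eventually_conj by blast
  then obtain n where n: "card Y * b ^ n < 1" "n \<ge> 1" using eventually_happens by force
  define I where "I = Sigma Y (fibre \<Lambda> f n)"
  define c where "c i = exp (- (3 * \<epsilon> * n)) * deriv_prod f D n (snd i)" for i :: "'a \<times> 'a"
  have I: "finite I" using Y(1) finite_fibre by (auto simp: I_def)
  have I_mem: "fst i \<in> Y" "snd i \<in> \<Lambda>" "(f ^^ n) (snd i) = fst i" if "i \<in> I" for i
    using that by (auto simp: I_def fibre_def)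
  have c1: "c i > 1" if "i \<in> I" for i
  proof -
    have "lam ^ n = exp (n * ln lam)" using lam by (simp add: exp_of_nat_mult)
    then have "exp (- (3 * \<epsilon> * n)) * lam ^ n = exp (n * (ln lam - 3 * \<epsilon>))"
      by (simp add: algebra_simps flip: exp_add)
    also have "\<dots> > 1" using n(2) \<epsilon>_lam by simp
    finally have "1 < exp (- (3 * \<epsilon> * n)) * lam ^ n" .
    also have "\<dots> \<le> c i" unfolding c_def
      using deriv_prod_ge_power[OF I_mem(2)[OF that]] by (intro mult_left_mono) auto
    finally show ?thesis .
  qed
  have sum_c: "(\<Sum>i\<in>I. c i powr (- t)) \<le> 1"
  proof -
    have "c i powr (- t) = exp (3 * \<epsilon> * t) ^ n * deriv_prod f D n (snd i) powr (- t)" if "i \<in> I" for i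
    proof -
      have "c i powr (- t) = exp (- (3 * \<epsilon> * n)) powr (- t) * deriv_prod f D n (snd i) powr (- t)"
        unfolding c_def by (rule powr_mult)
      also have "exp (- (3 * \<epsilon> * n)) powr (- t) = exp (n * (3 * \<epsilon> * t))"
        by (simp add: exp_powr_real)
      finally show ?thesis by (simp add: exp_of_nat_mult)
    qed
    then have "(\<Sum>i\<in>I. c i powr (- t)) = (\<Sum>i\<in>I. exp (3 * \<epsilon> * t) ^ n * deriv_prod f D n (snd i) powr (- t))"
      by (intro sum.cong) auto
    also have "\<dots> = (\<Sum>y\<in>Y. exp (3 * \<epsilon> * t) ^ n * fibre_sum \<Lambda> f D t n y)"
      unfolding I_def fibre_sum_def sum_distrib_left
      using Y(1) finite_fibre by (subst sum.Sigma) (auto simp: case_prod_beta)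
    also have "\<dots> \<le> (\<Sum>y\<in>Y. exp (3 * \<epsilon> * t) ^ n * a ^ n)"
    proof (intro sum_mono mult_left_mono)
      fix y assume "y \<in> Y"
      then have "fibre_sum \<Lambda> f D t n y \<le> fibre_sup \<Lambda> f D t n" using Y fibre_sum_le_sup by blast
      also have "\<dots> \<le> a ^ n" using fibre_sup_mult_le_power[of t n 1] by (simp add: a_def)
      finally show "fibre_sum \<Lambda> f D t n y \<le> a ^ n" .
    qed simp
    also have "\<dots> = card Y * b ^ n" by (simp add: b_def power_mult_distrib)
    finally show ?thesis using n by simp
  qed
  have refine: "has_cover \<Lambda> \<delta> (\<Sum>i\<in>I. k i)"
    if cov: "\<And>i. i \<in> I \<Longrightarrow> has_cover \<Lambda> (c i * \<delta>) (k i)" for \<delta> k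
  proof -
    have "\<forall>i\<in>I. \<exists>\<U>. finite \<U> \<and> card \<U> \<le> k i \<and> \<Lambda> \<subseteq> \<Union>\<U> \<and>
         (\<forall>U\<in>\<U>. \<forall>u\<in>U. \<forall>v\<in>U. dist u v \<le> c i * \<delta>)"
      using cov[unfolded has_cover_def] by simp
    from bchoice[OF this] obtain \<U> where
      "\<forall>i\<in>I. finite (\<U> i) \<and> card (\<U> i) \<le> k i \<and> \<Lambda> \<subseteq> \<Union>(\<U> i) \<and>
         (\<forall>U\<in>\<U> i. \<forall>u\<in>U. \<forall>v\<in>U. dist u v \<le> c i * \<delta>)"
      by (elim exE)
    then have \<U>: "\<And>i. i \<in> I \<Longrightarrow> finite (\<U> i)" "\<And>i. i \<in> I \<Longrightarrow> card (\<U> i) \<le> k i"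
      "\<And>i. i \<in> I \<Longrightarrow> \<Lambda> \<subseteq> \<Union>(\<U> i)"
      "\<And>i U u v. i \<in> I \<Longrightarrow> U \<in> \<U> i \<Longrightarrow> u \<in> U \<Longrightarrow> v \<in> U \<Longrightarrow> dist u v \<le> c i * \<delta>"
      by simp_all
    define V where "V i U = {u \<in> \<Lambda>. (\<forall>k\<le>n. dist ((f ^^ k) (snd i)) ((f ^^ k) u) < r0) \<and> (f ^^ n) u \<in> U}"
      for i :: "'a \<times> 'a" and U
    define \<V> where "\<V> = (\<Union>i\<in>I. V i ` \<U> i)"
    have "finite \<V>" using I \<U>(1) by (auto simp: \<V>_def)
    moreover have "card \<V> \<le> (\<Sum>i\<in>I. k i)"
    proof -
      have "card \<V> \<le> (\<Sum>i\<in>I. card (V i ` \<U> i))" unfolding \<V>_def by (rule card_UN_le[OF I])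
      also have "\<dots> \<le> (\<Sum>i\<in>I. k i)"
        using \<U>(1,2) card_image_le order_trans by (intro sum_mono) blast
      finally show ?thesis .
    qed
    moreover have "\<Lambda> \<subseteq> \<Union>\<V>"
    proof
      fix u assume u: "u \<in> \<Lambda>"
      obtain y where y: "y \<in> Y" "dist ((f ^^ n) u) y < r0"
        using Y(3) funpow_in[OF u, of n] by (auto simp: subset_iff dist_commute)
      then obtain x where x: "x \<in> \<Lambda>" "(f ^^ n) x = y" "\<forall>k\<le>n. dist ((f ^^ k) u) ((f ^^ k) x) < r0"
        using r0(3)[OF u, of y n] Y(2) by blast
      have i: "(y, x) \<in> I" using x y by (auto simp: I_def fibre_def)
      obtain U where U: "U \<in> \<U> (y, x)" "(f ^^ n) u \<in> U" using \<U>(3)[OF i] funpow_in[OF u, of n] by blast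
      then have "u \<in> V (y, x) U" using u x(3) by (simp add: V_def dist_commute)
      with U i show "u \<in> \<Union>\<V>" by (auto simp: \<V>_def)
    qed
    moreover have "dist u v \<le> \<delta>" if W0: "W \<in> \<V>" "u \<in> W" "v \<in> W" for W u v
    proof -
      obtain i U where i: "i \<in> I" and U: "U \<in> \<U> i" and W: "W = V i U"
        using W0(1) unfolding \<V>_def by blast
      let ?x = "snd i"
      have uv: "u \<in> \<Lambda>" "v \<in> \<Lambda>" "(f ^^ n) u \<in> U" "(f ^^ n) v \<in> U" using W0 W by (auto simp: V_def)
      have near: "dist ((f ^^ k) ?x) ((f ^^ k) u) < r / 2" "dist ((f ^^ k) ?x) ((f ^^ k) v) < r / 2"
        if "k < n" for k
      proof -
        have "\<forall>k\<le>n. dist ((f ^^ k) ?x) ((f ^^ k) w) < r0" if "w \<in> W" for w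
          using that W by (simp add: V_def)
        then have "dist ((f ^^ k) ?x) ((f ^^ k) w) < r0" if "w \<in> W" for w
          using that \<open>k < n\<close> by simp
        then show "dist ((f ^^ k) ?x) ((f ^^ k) u) < r / 2" "dist ((f ^^ k) ?x) ((f ^^ k) v) < r / 2"
          using W0(2,3) r0(2) less_le_trans by blast+
      qed
      have near2: "dist ((f ^^ k) u) ((f ^^ k) v) < r" if "k < n" for k
        using near[OF that] dist_triangle3[of "(f ^^ k) u" "(f ^^ k) v" "(f ^^ k) ?x"] by simp
      have "exp (- (2 * \<epsilon> * n)) * deriv_prod f D n ?x \<le> deriv_prod f D n u"
        using near(1) r by (intro shadow_deriv[OF ac \<epsilon> I_mem(2)[OF i] uv(1)]) force
      then have "exp (- (\<epsilon> * n)) * (exp (- (2 * \<epsilon> * n)) * deriv_prod f D n ?x) * dist u v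
          \<le> exp (- (\<epsilon> * n)) * deriv_prod f D n u * dist u v"
        by (intro mult_right_mono mult_left_mono) auto
      also have "\<dots> \<le> dist ((f ^^ n) u) ((f ^^ n) v)" by (rule shadow_expand[OF ac uv(1,2) near2])
      also have "\<dots> \<le> c i * \<delta>" using \<U>(4)[OF i U uv(3,4)] .
      also have "exp (- (\<epsilon> * n)) * (exp (- (2 * \<epsilon> * n)) * deriv_prod f D n ?x) = c i"
        by (simp add: c_def algebra_simps flip: exp_add)
      finally show ?thesis using c1[OF i] by simp
    qed
    ultimately show ?thesis by (rule has_coverI)
  qed
  show ?thesis using I c1 sum_c refine by (intro exI[of _ I] exI[of _ c]) simp
qed

text \<open>
  Induction over the scale.  A cover at scale \<open>\<delta>\<close> is assembled from covers at the scales
  \<open>c i * \<delta>\<close>, and the bound \<open>C * \<delta> powr (- t)\<close> reproduces itself because the \<open>c i powr (- t)\<close> add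
  up to at most \<open>1\<close>.
\<close>
lemma covering_growth:
  assumes "t \<ge> 0" and "fibre_sup \<Lambda> f D t 1 < 1"
  shows "\<exists>C>0. \<forall>\<delta>. 0 < \<delta> \<and> \<delta> < 1 \<longrightarrow> (\<exists>k. real k \<le> C * \<delta> powr (- t) \<and> has_cover \<Lambda> \<delta> k)"
proof -
  obtain I :: "('a \<times> 'a) set" and c :: "'a \<times> 'a \<Rightarrow> real" where I: "finite I"
    and c1': "\<forall>i\<in>I. c i > 1" and sum_c: "(\<Sum>i\<in>I. c i powr (- t)) \<le> 1"
    and refine: "\<forall>\<delta> k. (\<forall>i\<in>I. has_cover \<Lambda> (c i * \<delta>) (k i)) \<longrightarrow> has_cover \<Lambda> \<delta> (\<Sum>i\<in>I. k i)"
    using cover_refinement[OF assms] by blast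
  have c1: "c i > 1" if "i \<in> I" for i using c1' that by blast
  \<comment> \<open>The value \<open>2\<close> keeps the minimum and the maximum defined if \<open>I\<close> is empty.\<close>
  define cmin where "cmin = Min (insert 2 (c ` I))"
  define cmax where "cmax = Max (insert 2 (c ` I))"
  have cmin: "cmin > 1" "\<And>i. i \<in> I \<Longrightarrow> cmin \<le> c i"
    unfolding cmin_def using I c1 by (auto intro: Min_le)
  have cmax: "cmax \<ge> 2" "\<And>i. i \<in> I \<Longrightarrow> c i \<le> cmax"
    unfolding cmax_def using I by auto
  obtain k1 where k1: "has_cover \<Lambda> 1 k1" using has_cover_exists[of 1] by auto
  define C where "C = (real k1 + 1) * cmax powr t"
  have C: "C > 0" using cmax by (simp add: C_def)
  have base: "real k1 \<le> C * \<delta> powr (- t)" if "1 \<le> \<delta>" "\<delta> \<le> cmax" for \<delta>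
  proof -
    have "1 = cmax powr t * cmax powr (- t)" using cmax(1) by (simp flip: powr_add)
    also have "\<dots> \<le> cmax powr t * \<delta> powr (- t)"
      using that assms(1) by (intro mult_left_mono powr_mono2') auto
    finally have "(real k1 + 1) * 1 \<le> (real k1 + 1) * (cmax powr t * \<delta> powr (- t))"
      by (rule mult_left_mono) simp
    also have "\<dots> = C * \<delta> powr (- t)" by (simp add: C_def)
    finally have "real k1 + 1 \<le> C * \<delta> powr (- t)" by (simp only: mult_1_right)
    then show ?thesis by linarith
  qed
  \<comment> \<open>Scales up to \<open>cmax\<close> have to be included, as \<open>c i * \<delta>\<close> may exceed \<open>1\<close> when \<open>\<delta>\<close> does not.\<close>
  have step: "\<exists>k. real k \<le> C * \<delta> powr (- t) \<and> has_cover \<Lambda> \<delta> k"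
    if "0 < \<delta>" "\<delta> \<le> cmax" "1 \<le> cmin ^ n * \<delta>" for n \<delta>
    using that
  proof (induction n arbitrary: \<delta>)
    case 0
    then show ?case using base[of \<delta>] has_cover_mono[OF k1] by (intro exI[of _ k1]) auto
  next
    case (Suc n)
    show ?case
    proof (cases "1 \<le> \<delta>")
      case True
      then show ?thesis using Suc.prems base[of \<delta>] has_cover_mono[OF k1] by (intro exI[of _ k1]) auto
    next
      case False
      have "\<exists>k. real k \<le> C * (c i * \<delta>) powr (- t) \<and> has_cover \<Lambda> (c i * \<delta>) k" if i: "i \<in> I" for i
      proof (rule Suc.IH)
        show "0 < c i * \<delta>" using c1[OF i] Suc.prems by simp
        have "c i * \<delta> \<le> cmax * 1" using cmax(2)[OF i] c1[OF i] False Suc.prems cmax(1)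
          by (intro mult_mono) auto
        then show "c i * \<delta> \<le> cmax" by simp
        have "1 \<le> cmin ^ n * (cmin * \<delta>)" using Suc.prems by (simp add: mult_ac)
        also have "\<dots> \<le> cmin ^ n * (c i * \<delta>)"
          using cmin Suc.prems(1) i by (intro mult_left_mono mult_right_mono) auto
        finally show "1 \<le> cmin ^ n * (c i * \<delta>)" .
      qed
      then obtain k where k: "\<And>i. i \<in> I \<Longrightarrow> real (k i) \<le> C * (c i * \<delta>) powr (- t)"
        "\<And>i. i \<in> I \<Longrightarrow> has_cover \<Lambda> (c i * \<delta>) (k i)" by metis
      have "real (\<Sum>i\<in>I. k i) \<le> (\<Sum>i\<in>I. C * (c i * \<delta>) powr (- t))"
        using k(1) by (simp add: sum_mono)
      also have "\<dots> = (\<Sum>i\<in>I. c i powr (- t)) * (C * \<delta> powr (- t))"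
        unfolding sum_distrib_right using c1 Suc.prems(1)
        by (intro sum.cong) (simp_all add: powr_mult less_imp_le order.strict_trans[OF zero_less_one] mult_ac)
      also have "\<dots> \<le> 1 * (C * \<delta> powr (- t))"
        using sum_c C by (intro mult_right_mono) auto
      finally show ?thesis using refine k(2) by (intro exI[of _ "\<Sum>i\<in>I. k i"]) simp
    qed
  qed
  have "\<exists>k. real k \<le> C * \<delta> powr (- t) \<and> has_cover \<Lambda> \<delta> k" if \<delta>: "0 < \<delta>" "\<delta> < 1" for \<delta>
  proof -
    obtain n where "1 / \<delta> < cmin ^ n" using cmin(1) real_arch_pow by blast
    then have "1 \<le> cmin ^ n * \<delta>" using \<delta> by (simp add: field_simps)
    then show ?thesis using step \<delta> cmax(1) by simp
  qed
  with C show ?thesis by blast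
qed

end

section \<open>Uniform conformality from differentiability of class C1\<close>

text \<open>
  For a limit point \<open>x\<close> the pairs \<open>(x, v)\<close> approach \<open>(x, x)\<close>; this makes the derivative the actual
  limit, not merely a value chosen by \<open>Lim\<close>.
\<close>
lemma conformal_filter_nontrivial:
  assumes "x \<in> \<Lambda>" "x islimpt \<Lambda>"
  shows "conformal_filter \<Lambda> x \<noteq> bot"
proof -
  have "(x, x) islimpt {(u, v). u \<in> \<Lambda> \<and> v \<in> \<Lambda> \<and> u \<noteq> v}"
    unfolding islimpt_approachable
  proof (intro allI impI)
    fix e :: real assume "e > 0"
    then obtain v where "v \<in> \<Lambda>" "v \<noteq> x" "dist v x < e"
      using assms(2) unfolding islimpt_approachable by blast
    then show "\<exists>p\<in>{(u, v). u \<in> \<Lambda> \<and> v \<in> \<Lambda> \<and> u \<noteq> v}. p \<noteq> (x, x) \<and> dist p (x, x) < e"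
      using assms(1) by (intro bexI[of _ "(x, v)"]) (auto simp: dist_Pair_Pair)
  qed
  then show ?thesis unfolding conformal_filter_def by (simp add: trivial_limit_within)
qed

lemma eventually_conformal_filterI:
  assumes "d > 0" "\<And>u v. u \<in> \<Lambda> \<Longrightarrow> v \<in> \<Lambda> \<Longrightarrow> u \<noteq> v \<Longrightarrow> dist u x < d \<Longrightarrow> dist v x < d \<Longrightarrow> P (u, v)"
  shows "eventually P (conformal_filter \<Lambda> x)"
  unfolding conformal_filter_def eventually_at
proof (intro exI[of _ d] conjI ballI impI assms(1))
  fix p assume p: "p \<in> {(u, v). u \<in> \<Lambda> \<and> v \<in> \<Lambda> \<and> u \<noteq> v}" "p \<noteq> (x, x) \<and> dist p (x, x) < d"
  obtain u v where uv: "p = (u, v)" by (cases p)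
  have "dist u x < d" "dist v x < d"
    using p(2) dist_fst_le[of p "(x, x)"] dist_snd_le[of p "(x, x)"] by (auto simp: uv)
  with p(1) uv assms(2) show "P p" by auto
qed

lemma eventually_conformal_filterE:
  assumes "eventually P (conformal_filter \<Lambda> x)"
  obtains d where "d > 0"
    "\<And>u v. u \<in> \<Lambda> \<Longrightarrow> v \<in> \<Lambda> \<Longrightarrow> u \<noteq> v \<Longrightarrow> dist u x < d \<Longrightarrow> dist v x < d \<Longrightarrow> P (u, v)"
proof -
  obtain d where d: "d > 0" and P: "\<forall>p\<in>{(u, v). u \<in> \<Lambda> \<and> v \<in> \<Lambda> \<and> u \<noteq> v}.
      p \<noteq> (x, x) \<and> dist p (x, x) < d \<longrightarrow> P p"
    using assms unfolding conformal_filter_def eventually_at by blast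
  have "P (u, v)" if "u \<in> \<Lambda>" "v \<in> \<Lambda>" "u \<noteq> v" "dist u x < d / 2" "dist v x < d / 2" for u v
  proof -
    have "dist (u, v) (x, x) \<le> dist u x + dist v x"
      by (simp add: dist_Pair_Pair sqrt_sum_squares_le_sum)
    then have "dist (u, v) (x, x) < d" using that by simp
    then show ?thesis using P that by auto
  qed
  with d that[of "d / 2"] show thesis by simp
qed

text \<open>
  The bounds for the difference quotients near \<open>x\<close> carry over to the derivatives at nearby points
  \<open>u\<close>, which are limits of such quotients.  This is where the double limit enters: both points of
  the pair vary.
\<close>
lemma local_conformal_bounds:
  assumes perfect: "\<forall>x\<in>\<Lambda>. x islimpt \<Lambda>" and C1: "\<forall>x\<in>\<Lambda>. C1_conformal_at \<Lambda> f x"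
    and x: "x \<in> \<Lambda>" and D: "conformal_deriv \<Lambda> f x > 0" and "\<epsilon> > 0"
  shows "\<exists>d>0.
    (\<forall>u\<in>\<Lambda> \<inter> ball x d. \<forall>v\<in>\<Lambda> \<inter> ball x d. u \<noteq> v \<longrightarrow>
       exp (- \<epsilon>) * conformal_deriv \<Lambda> f x \<le> dist (f u) (f v) / dist u v \<and>
       dist (f u) (f v) / dist u v \<le> exp \<epsilon> * conformal_deriv \<Lambda> f x) \<and>
    (\<forall>u\<in>\<Lambda> \<inter> ball x d.
       exp (- \<epsilon>) * conformal_deriv \<Lambda> f x \<le> conformal_deriv \<Lambda> f u \<and>
       conformal_deriv \<Lambda> f u \<le> exp \<epsilon> * conformal_deriv \<Lambda> f x)"
proof -
  let ?L = "conformal_deriv \<Lambda> f x" and ?r = "\<lambda>(u, v). dist (f u) (f v) / dist u v"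
  have lim: "(?r \<longlongrightarrow> conformal_deriv \<Lambda> f u) (conformal_filter \<Lambda> u)" if u: "u \<in> \<Lambda>" for u
  proof -
    obtain l where l: "(?r \<longlongrightarrow> l) (conformal_filter \<Lambda> u)"
      using C1 u unfolding C1_conformal_at_def by blast
    then have "conformal_deriv \<Lambda> f u = l"
      unfolding conformal_deriv_def using u perfect
      by (intro tendsto_Lim conformal_filter_nontrivial) auto
    with l show ?thesis by simp
  qed
  have "exp (- \<epsilon>) * ?L < ?L" "?L < exp \<epsilon> * ?L" using D \<open>\<epsilon> > 0\<close> by simp_all
  then have "eventually (\<lambda>p. exp (- \<epsilon>) * ?L < ?r p) (conformal_filter \<Lambda> x)"
    "eventually (\<lambda>p. ?r p < exp \<epsilon> * ?L) (conformal_filter \<Lambda> x)"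
    using order_tendstoD[OF lim[OF x]] by auto
  then have "eventually (\<lambda>p. exp (- \<epsilon>) * ?L < ?r p \<and> ?r p < exp \<epsilon> * ?L) (conformal_filter \<Lambda> x)"
    by (rule eventually_conj)
  then obtain d where d: "d > 0" and bd: "\<And>u v. u \<in> \<Lambda> \<Longrightarrow> v \<in> \<Lambda> \<Longrightarrow> u \<noteq> v \<Longrightarrow> dist u x < d \<Longrightarrow> dist v x < d \<Longrightarrow>
      exp (- \<epsilon>) * ?L < ?r (u, v) \<and> ?r (u, v) < exp \<epsilon> * ?L"
    by (rule eventually_conformal_filterE) blast
  have "exp (- \<epsilon>) * ?L \<le> conformal_deriv \<Lambda> f u \<and> conformal_deriv \<Lambda> f u \<le> exp \<epsilon> * ?L"
    if u: "u \<in> \<Lambda> \<inter> ball x d" for u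
  proof -
    have ev: "eventually (\<lambda>p. exp (- \<epsilon>) * ?L \<le> ?r p \<and> ?r p \<le> exp \<epsilon> * ?L) (conformal_filter \<Lambda> u)"
    proof (rule eventually_conformal_filterI)
      show "d - dist x u > 0" using u by simp
      fix w v assume wv: "w \<in> \<Lambda>" "v \<in> \<Lambda>" "w \<noteq> v" "dist w u < d - dist x u" "dist v u < d - dist x u"
      then have "dist w x < d" "dist v x < d"
        using dist_triangle[of w x u] dist_triangle[of v x u] by (simp_all add: dist_commute)
      then show "exp (- \<epsilon>) * ?L \<le> ?r (w, v) \<and> ?r (w, v) \<le> exp \<epsilon> * ?L"
        using bd[OF wv(1-3)] by simp
    qed
    have nt: "conformal_filter \<Lambda> u \<noteq> bot" using u perfect by (intro conformal_filter_nontrivial) auto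
    have "u \<in> \<Lambda>" using u by simp
    show ?thesis
      using tendsto_lowerbound[OF lim[OF \<open>u \<in> \<Lambda>\<close>] _ nt] tendsto_upperbound[OF lim[OF \<open>u \<in> \<Lambda>\<close>] _ nt]
        eventually_conj_iff[of _ _ "conformal_filter \<Lambda> u"] ev by auto
  qed
  moreover have "exp (- \<epsilon>) * ?L \<le> dist (f u) (f v) / dist u v \<and> dist (f u) (f v) / dist u v \<le> exp \<epsilon> * ?L"
    if "u \<in> \<Lambda> \<inter> ball x d" "v \<in> \<Lambda> \<inter> ball x d" "u \<noteq> v" for u v
    using bd[of u v] that by (auto simp: dist_commute)
  ultimately show ?thesis using d by (intro exI[of _ d] conjI ballI impI) simp_all
qed

text \<open>
  A Lebesgue number of the cover by the balls from \<open>local_conformal_bounds\<close> is a uniform scale.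
\<close>
lemma conformal_map_of_C1:
  fixes \<Lambda> :: "'a::metric_space set"
  assumes "\<Lambda> \<noteq> {}" and cpt: "compact \<Lambda>" and perfect: "\<forall>x\<in>\<Lambda>. x islimpt \<Lambda>"
    and "continuous_on \<Lambda> f" and "f ` \<Lambda> = \<Lambda>" and C1: "\<forall>x\<in>\<Lambda>. C1_conformal_at \<Lambda> f x"
    and "open_map (top_of_set \<Lambda>) (top_of_set \<Lambda>) f"
    and m: "m > 0" "\<And>x. x \<in> \<Lambda> \<Longrightarrow> m \<le> conformal_deriv \<Lambda> f x"
  shows "conformal_map \<Lambda> f (conformal_deriv \<Lambda> f)"
proof
  let ?D = "conformal_deriv \<Lambda> f"
  have pos: "?D x > 0" if "x \<in> \<Lambda>" for x using m that by (meson less_le_trans)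
  have local: "\<exists>d>0.
    (\<forall>u\<in>\<Lambda> \<inter> ball x d. \<forall>v\<in>\<Lambda> \<inter> ball x d. u \<noteq> v \<longrightarrow>
       exp (- \<epsilon>) * ?D x \<le> dist (f u) (f v) / dist u v \<and>
       dist (f u) (f v) / dist u v \<le> exp \<epsilon> * ?D x) \<and>
    (\<forall>u\<in>\<Lambda> \<inter> ball x d. exp (- \<epsilon>) * ?D x \<le> ?D u \<and> ?D u \<le> exp \<epsilon> * ?D x)"
    if "x \<in> \<Lambda>" "\<epsilon> > 0" for x \<epsilon>
    using local_conformal_bounds[OF perfect C1 that(1) pos[OF that(1)] that(2)] .
  show "\<exists>m>0. \<forall>x\<in>\<Lambda>. m \<le> ?D x" using m by blast
  show "\<exists>M. \<forall>x\<in>\<Lambda>. ?D x \<le> M"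
  proof -
    have "\<exists>d>0. \<forall>u\<in>\<Lambda> \<inter> ball x d. ?D u \<le> exp 1 * ?D x" if "x \<in> \<Lambda>" for x
      using local[OF that, of 1] by auto
    then obtain d where d: "\<And>x. x \<in> \<Lambda> \<Longrightarrow> d x > 0"
      "\<And>x u. x \<in> \<Lambda> \<Longrightarrow> u \<in> \<Lambda> \<inter> ball x (d x) \<Longrightarrow> ?D u \<le> exp 1 * ?D x" by metis
    obtain F where F: "F \<subseteq> \<Lambda>" "finite F" "\<Lambda> \<subseteq> (\<Union>x\<in>F. ball x (d x))"
      by (rule compactE_image[OF cpt, of \<Lambda> "\<lambda>x. ball x (d x)"]) (use d(1) in auto)
    have "?D u \<le> (\<Sum>x\<in>F. exp 1 * ?D x)" if u: "u \<in> \<Lambda>" for u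
    proof -
      obtain x where x: "x \<in> F" "u \<in> ball x (d x)" using F(3) u by blast
      then have "?D u \<le> exp 1 * ?D x" using d(2) F(1) u by blast
      also have "\<dots> \<le> (\<Sum>x\<in>F. exp 1 * ?D x)"
        using F(1) pos by (intro member_le_sum[OF x(1) _ F(2)]) (auto intro!: less_imp_le)
      finally show ?thesis .
    qed
    then show ?thesis by blast
  qed
  fix \<epsilon> :: real assume "\<epsilon> > 0"
  then have e: "\<epsilon> / 2 > 0" by simp
  have "\<forall>x\<in>\<Lambda>. \<exists>d>0.
    (\<forall>u\<in>\<Lambda> \<inter> ball x d. \<forall>v\<in>\<Lambda> \<inter> ball x d. u \<noteq> v \<longrightarrow>
       exp (- (\<epsilon>/2)) * ?D x \<le> dist (f u) (f v) / dist u v \<and>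
       dist (f u) (f v) / dist u v \<le> exp (\<epsilon>/2) * ?D x) \<and>
    (\<forall>u\<in>\<Lambda> \<inter> ball x d. exp (- (\<epsilon>/2)) * ?D x \<le> ?D u \<and> ?D u \<le> exp (\<epsilon>/2) * ?D x)"
    by (intro ballI local e)
  from bchoice[OF this] obtain d where d: "\<forall>x\<in>\<Lambda>. d x > 0 \<and>
    (\<forall>u\<in>\<Lambda> \<inter> ball x (d x). \<forall>v\<in>\<Lambda> \<inter> ball x (d x). u \<noteq> v \<longrightarrow>
       exp (- (\<epsilon>/2)) * ?D x \<le> dist (f u) (f v) / dist u v \<and>
       dist (f u) (f v) / dist u v \<le> exp (\<epsilon>/2) * ?D x) \<and>
    (\<forall>u\<in>\<Lambda> \<inter> ball x (d x). exp (- (\<epsilon>/2)) * ?D x \<le> ?D u \<and> ?D u \<le> exp (\<epsilon>/2) * ?D x)"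
    by (elim exE)
  obtain r where r: "0 < r" and leb: "\<And>x. x \<in> \<Lambda> \<Longrightarrow> \<exists>G\<in>(\<lambda>x. ball x (d x)) ` \<Lambda>. ball x r \<subseteq> G"
    by (rule Heine_Borel_lemma[OF cpt, of "(\<lambda>x. ball x (d x)) ` \<Lambda>"]) (use d in auto)
  have "exp (- \<epsilon>) * ?D u * dist u v \<le> dist (f u) (f v) \<and> dist (f u) (f v) \<le> exp \<epsilon> * ?D u * dist u v"
    if uv: "u \<in> \<Lambda>" "v \<in> \<Lambda>" "dist u v < r" for u v
  proof (cases "u = v")
    case False
    obtain x where x: "x \<in> \<Lambda>" "ball u r \<subseteq> ball x (d x)" using leb[OF uv(1)] by blast
    have "u \<in> ball u r" "v \<in> ball u r" using r uv(3) by simp_all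
    then have mem: "u \<in> \<Lambda> \<inter> ball x (d x)" "v \<in> \<Lambda> \<inter> ball x (d x)" using x(2) uv by blast+
    have ratio: "exp (- (\<epsilon>/2)) * ?D x \<le> dist (f u) (f v) / dist u v"
       "dist (f u) (f v) / dist u v \<le> exp (\<epsilon>/2) * ?D x"
      and Du: "exp (- (\<epsilon>/2)) * ?D x \<le> ?D u" "?D u \<le> exp (\<epsilon>/2) * ?D x"
      using d[THEN bspec, OF x(1)] mem False by simp_all
    have "exp (- \<epsilon>) * ?D u \<le> exp (- \<epsilon>) * (exp (\<epsilon>/2) * ?D x)" using Du(2) by simp
    also have "\<dots> = exp (- (\<epsilon>/2)) * ?D x" by (simp flip: exp_add mult.assoc)
    also note ratio(1)
    finally have lo: "exp (- \<epsilon>) * ?D u \<le> dist (f u) (f v) / dist u v" .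
    have "exp (\<epsilon>/2) * ?D x = exp \<epsilon> * (exp (- (\<epsilon>/2)) * ?D x)" by (simp flip: exp_add mult.assoc)
    also have "\<dots> \<le> exp \<epsilon> * ?D u" using Du(1) by simp
    finally have "dist (f u) (f v) / dist u v \<le> exp \<epsilon> * ?D u" using ratio(2) by simp
    with lo False show ?thesis by (simp add: field_simps)
  qed simp
  then show "\<exists>r>0. almost_conformal \<Lambda> f ?D \<epsilon> r" using r unfolding almost_conformal_def
    by (intro exI[of _ r] conjI ballI impI) auto
qed (use assms in auto)

text \<open>
  The fibres are finite and the fibre sums bounded, so the extended values in the definition of
  the pressure are real numbers.
\<close>
lemma (in conformal_map) pressure_eq:
  assumes "D = conformal_deriv \<Lambda> f"
  shows "pressure s \<Lambda> f = liminf (\<lambda>n. ereal (ln (fibre_sup \<Lambda> f D s n) / n))"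
proof -
  have iter: "conformal_deriv_iter \<Lambda> f n x = deriv_prod f D n x" for n x
    by (simp add: conformal_deriv_iter_def deriv_prod_def assms)
  have sum: "(\<Sum>\<^sub>\<infinity>x\<in>{x\<in>\<Lambda>. (f ^^ n) x = y}. ennreal (conformal_deriv_iter \<Lambda> f n x powr (- s)))
      = ennreal (fibre_sum \<Lambda> f D s n y)" for n y
    unfolding fibre_def[symmetric] iter fibre_sum_def
    by (simp add: finite_fibre sum_ennreal)
  have sup: "(SUP y\<in>\<Lambda>. ennreal (fibre_sum \<Lambda> f D s n y)) = ennreal (fibre_sup \<Lambda> f D s n)" (is "?S = _") for n
  proof (rule antisym)
    show le: "?S \<le> ennreal (fibre_sup \<Lambda> f D s n)"
      by (intro SUP_least ennreal_leI fibre_sum_le_sup)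
    then obtain z where z: "z \<ge> 0" "?S = ennreal z" by (cases ?S) (auto simp: top_unique)
    have "fibre_sup \<Lambda> f D s n \<le> z"
    proof (rule fibre_sup_le)
      fix y assume "y \<in> \<Lambda>"
      then have "ennreal (fibre_sum \<Lambda> f D s n y) \<le> ?S" by (rule SUP_upper)
      then show "fibre_sum \<Lambda> f D s n y \<le> z" using z by simp
    qed
    then show "ennreal (fibre_sup \<Lambda> f D s n) \<le> ?S" using z by (simp add: ennreal_leI)
  qed
  show ?thesis unfolding pressure_def sum sup
    by (simp add: eln_ennreal fibre_sup_pos)
qed

section \<open>The pressure function and its zero\<close>

definition (in conformal_map) growth_rate :: "real \<Rightarrow> ereal" where
  "growth_rate s = liminf (\<lambda>n. ereal (ln (fibre_sup \<Lambda> f D s n) / n))"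

locale conformal_repeller = conformal_map +
  fixes C \<beta> :: real
  assumes C: "C > 0" and \<beta>: "\<beta> > 1"
    and expansion: "\<And>x n. x \<in> \<Lambda> \<Longrightarrow> C * \<beta> ^ n \<le> deriv_prod f D n x"
begin

lemma growth_rate_decrease:
  assumes "h \<ge> 0"
  shows "growth_rate (s + h) \<le> growth_rate s - ereal (h * ln \<beta>)"
proof -
  let ?u = "\<lambda>n. - (h * ln C) / real n - h * ln \<beta>"
  have "(\<lambda>n. ?u n) \<longlonglongrightarrow> 0 - h * ln \<beta>"
    by (intro tendsto_intros lim_const_over_n)
  then have lim: "(\<lambda>n. ereal (?u n)) \<longlonglongrightarrow> ereal (- (h * ln \<beta>))" by simp
  have le: "ln (fibre_sup \<Lambda> f D (s + h) n) / n \<le> ?u n + ln (fibre_sup \<Lambda> f D s n) / n" if "n \<ge> 1" for n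
  proof -
    have "fibre_sup \<Lambda> f D (s + h) n \<le> (C * \<beta> ^ n) powr (- h) * fibre_sup \<Lambda> f D s n"
      using C \<beta> expansion assms by (intro fibre_sup_shift_le) auto
    then have "ln (fibre_sup \<Lambda> f D (s + h) n) \<le> ln ((C * \<beta> ^ n) powr (- h) * fibre_sup \<Lambda> f D s n)"
      using fibre_sup_pos by (intro ln_mono) auto
    also have "\<dots> = - h * ln (C * \<beta> ^ n) + ln (fibre_sup \<Lambda> f D s n)"
      using C \<beta> fibre_sup_pos[of s n] by (simp add: ln_mult ln_powr)
    also have "ln (C * \<beta> ^ n) = ln C + n * ln \<beta>" using C \<beta> by (simp add: ln_mult ln_realpow)
    finally have "ln (fibre_sup \<Lambda> f D (s + h) n) / n
        \<le> (- h * (ln C + n * ln \<beta>) + ln (fibre_sup \<Lambda> f D s n)) / n"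
      by (rule divide_right_mono) simp
    also have "\<dots> = ?u n + ln (fibre_sup \<Lambda> f D s n) / n" using that by (simp add: field_simps)
    finally show ?thesis .
  qed
  have "eventually (\<lambda>n. ereal (ln (fibre_sup \<Lambda> f D (s + h) n) / n)
      \<le> ereal (?u n) + ereal (ln (fibre_sup \<Lambda> f D s n) / n)) sequentially"
    using eventually_ge_at_top[of 1] by eventually_elim (use le in simp)
  then have "growth_rate (s + h)
      \<le> liminf (\<lambda>n. ereal (?u n) + ereal (ln (fibre_sup \<Lambda> f D s n) / n))"
    unfolding growth_rate_def by (rule Liminf_mono)
  also have "\<dots> = ereal (- (h * ln \<beta>)) + growth_rate s"
    unfolding growth_rate_def by (rule ereal_liminf_lim_add[OF lim]) simp
  also have "\<dots> = growth_rate s - ereal (h * ln \<beta>)"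
    by (simp add: minus_ereal_def add.commute)
  finally show ?thesis .
qed

lemma growth_rate_decrease_bounded:
  "\<exists>L\<ge>0. \<forall>s h. h \<ge> 0 \<longrightarrow> growth_rate s \<le> ereal (h * L) + growth_rate (s + h)"
proof -
  obtain M0 where M0: "\<forall>x\<in>\<Lambda>. D x \<le> M0" using bounded_above by blast
  define M where "M = max 1 M0"
  have M: "M \<ge> 1" "\<And>x. x \<in> \<Lambda> \<Longrightarrow> D x \<le> M" using M0 by (auto simp: M_def le_max_iff_disj)
  have prod_le: "deriv_prod f D n x \<le> M ^ n" if "x \<in> \<Lambda>" for n x
    unfolding deriv_prod_def using M(2) pos funpow_in[OF that]
    by (intro prod_le_power M(1)) (auto intro: less_imp_le)
  have "growth_rate s \<le> ereal (h * ln M) + growth_rate (s + h)" if h: "h \<ge> 0" for s h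
  proof -
    have le: "ln (fibre_sup \<Lambda> f D s n) / n \<le> h * ln M + ln (fibre_sup \<Lambda> f D (s + h) n) / n"
      if "n \<ge> 1" for n
    proof -
      have "fibre_sup \<Lambda> f D s n \<le> (M ^ n) powr h * fibre_sup \<Lambda> f D (s + h) n"
        by (intro fibre_sup_shift_ge h prod_le)
      then have "ln (fibre_sup \<Lambda> f D s n) \<le> ln ((M ^ n) powr h * fibre_sup \<Lambda> f D (s + h) n)"
        using fibre_sup_pos by (intro ln_mono) auto
      also have "\<dots> = h * (n * ln M) + ln (fibre_sup \<Lambda> f D (s + h) n)"
        using M(1) fibre_sup_pos[of "s + h" n] by (simp add: ln_mult ln_powr ln_realpow)
      finally have "ln (fibre_sup \<Lambda> f D s n) / n \<le> (h * (n * ln M) + ln (fibre_sup \<Lambda> f D (s + h) n)) / n"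
        by (rule divide_right_mono) simp
      also have "\<dots> = h * ln M + ln (fibre_sup \<Lambda> f D (s + h) n) / n"
        using that by (simp add: field_simps)
      finally show ?thesis .
    qed
    have "eventually (\<lambda>n. ereal (ln (fibre_sup \<Lambda> f D s n) / n)
        \<le> ereal (h * ln M) + ereal (ln (fibre_sup \<Lambda> f D (s + h) n) / n)) sequentially"
      using eventually_ge_at_top[of 1] by eventually_elim (use le in simp)
    then have "growth_rate s
        \<le> liminf (\<lambda>n. ereal (h * ln M) + ereal (ln (fibre_sup \<Lambda> f D (s + h) n) / n))"
      unfolding growth_rate_def by (rule Liminf_mono)
    also have "\<dots> = ereal (h * ln M) + growth_rate (s + h)"
      unfolding growth_rate_def by (rule ereal_liminf_lim_add[OF tendsto_const]) simp
    finally show ?thesis .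
  qed
  moreover have "ln M \<ge> 0" using M(1) by simp
  ultimately show ?thesis by blast
qed

lemma growth_rate_0_nonneg: "growth_rate 0 \<ge> 0"
  unfolding growth_rate_def by (intro Liminf_bounded always_eventually allI)
    (simp add: ln_ge_zero[OF fibre_sup_0_ge_1])

lemma growth_rate_0_finite: "growth_rate 0 \<le> ereal (ln (fibre_sup \<Lambda> f D 0 1))"
proof -
  have "ln (fibre_sup \<Lambda> f D 0 n) / n \<le> ln (fibre_sup \<Lambda> f D 0 1)" if "n \<ge> 1" for n
  proof -
    have "ln (fibre_sup \<Lambda> f D 0 n) \<le> ln (fibre_sup \<Lambda> f D 0 1 ^ n)"
      using fibre_sup_mult_le_power[of 0 n 1] fibre_sup_pos by (intro ln_mono) auto
    also have "\<dots> = n * ln (fibre_sup \<Lambda> f D 0 1)" using fibre_sup_pos by (simp add: ln_realpow)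
    finally show ?thesis using that by (simp add: field_simps)
  qed
  then have "eventually (\<lambda>n. ereal (ln (fibre_sup \<Lambda> f D 0 n) / n) \<le> ereal (ln (fibre_sup \<Lambda> f D 0 1))) sequentially"
    unfolding eventually_sequentially by (intro exI[of _ 1]) auto
  then have "growth_rate 0 \<le> liminf (\<lambda>n. ereal (ln (fibre_sup \<Lambda> f D 0 1)))"
    unfolding growth_rate_def by (rule Liminf_mono)
  then show ?thesis by (simp add: Liminf_const)
qed

text \<open>
  On the nonnegative axis the growth rate is finite, Lipschitz and decreasing at rate at least
  \<open>ln \<beta>\<close>; hence it reaches \<open>0\<close> no later than at \<open>growth_rate 0 / ln \<beta>\<close>.
\<close>
lemma growth_rate_zero:
  obtains s where "s \<ge> 0" "growth_rate s = 0" "\<And>t. t < s \<Longrightarrow> growth_rate t > 0"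
    "\<And>t. t > s \<Longrightarrow> growth_rate t < 0"
proof -
  obtain L where L: "L \<ge> 0" "\<And>s h. h \<ge> 0 \<Longrightarrow> growth_rate s \<le> ereal (h * L) + growth_rate (s + h)"
    using growth_rate_decrease_bounded by blast
  have fin: "\<bar>growth_rate s\<bar> \<noteq> \<infinity>" if "s \<ge> 0" for s
  proof -
    have "growth_rate s \<le> growth_rate 0 - ereal (s * ln \<beta>)"
      using growth_rate_decrease[OF that, of 0] by simp
    also have "\<dots> \<le> ereal (ln (fibre_sup \<Lambda> f D 0 1)) - ereal (s * ln \<beta>)"
      by (intro ereal_minus_mono growth_rate_0_finite) simp
    finally have "growth_rate s \<noteq> \<infinity>" by auto
    moreover have "0 \<le> ereal (s * L) + growth_rate s"
      using order_trans[OF growth_rate_0_nonneg L(2)[OF that, of 0]] by simp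
    then have "growth_rate s \<noteq> - \<infinity>" by auto
    ultimately show ?thesis by (cases "growth_rate s") auto
  qed
  define p where "p s = real_of_ereal (growth_rate s)" for s
  have p: "growth_rate s = ereal (p s)" if "s \<ge> 0" for s
    using fin[OF that] unfolding p_def by (simp add: ereal_real')
  have p_upper: "p (s + h) \<le> p s - h * ln \<beta>" if "s \<ge> 0" "h \<ge> 0" for s h
    using growth_rate_decrease[OF that(2), of s] that by (simp add: p)
  have p_lower: "p s \<le> h * L + p (s + h)" if "s \<ge> 0" "h \<ge> 0" for s h
    using L(2)[OF that(2), of s] that by (simp add: p)
  have lnb: "ln \<beta> > 0" using \<beta> by simp
  have p0: "p 0 \<ge> 0" using growth_rate_0_nonneg by (simp add: p)
  define T where "T = p 0 / ln \<beta>"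
  have T: "T \<ge> 0" "p T \<le> 0" using p0 lnb p_upper[of 0 T] by (simp_all add: T_def)
  have dist_le: "\<bar>p x - p y\<bar> \<le> L * \<bar>x - y\<bar>" if "0 \<le> x" "x \<le> y" for x y
  proof -
    have "p y \<le> p x - (y - x) * ln \<beta>" "p x \<le> (y - x) * L + p y"
      using p_upper[of x "y - x"] p_lower[of x "y - x"] that by simp_all
    moreover have "(y - x) * ln \<beta> \<ge> 0" using that lnb by simp
    ultimately show ?thesis using that by (simp add: abs_if mult.commute[of L])
  qed
  have "L-lipschitz_on {0..T} p"
  proof (rule lipschitz_onI)
    fix x y assume "x \<in> {0..T}" "y \<in> {0..T}"
    then show "dist (p x) (p y) \<le> L * dist x y"
      using dist_le[of x y] dist_le[of y x] unfolding dist_real_def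
      by (cases "x \<le> y") (auto simp: abs_minus_commute)
  qed (rule L(1))
  then have "continuous_on {0..T} p" by (rule lipschitz_on_continuous_on)
  then obtain s where s: "0 \<le> s" "p s = 0"
    using IVT2'[of p T 0 0] T p0 by auto
  have s0: "growth_rate s = 0" using s p by simp
  show thesis
  proof (rule that[OF s(1) s0])
    fix t assume "t < s"
    have "growth_rate (t + (s - t)) \<le> growth_rate t - ereal ((s - t) * ln \<beta>)"
      using \<open>t < s\<close> by (intro growth_rate_decrease) simp
    then have "0 \<le> growth_rate t - ereal ((s - t) * ln \<beta>)" using s0 by simp
    moreover have "(s - t) * ln \<beta> > 0" using \<open>t < s\<close> lnb by simp
    ultimately show "growth_rate t > 0" by (cases "growth_rate t") auto
  next
    fix t assume "t > s"
    have "growth_rate (s + (t - s)) \<le> growth_rate s - ereal ((t - s) * ln \<beta>)"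
      using \<open>t > s\<close> by (intro growth_rate_decrease) simp
    then have "growth_rate t \<le> - ereal ((t - s) * ln \<beta>)" using s0 by simp
    moreover have "(t - s) * ln \<beta> > 0" using \<open>t > s\<close> lnb by simp
    ultimately show "growth_rate t < 0" by (cases "growth_rate t") auto
  qed
qed

lemma expanding_iterate:
  "\<exists>k\<ge>1. \<forall>q\<ge>k. expanding_conformal_map \<Lambda> (f ^^ q) (deriv_prod f D q) 2"
proof -
  obtain k where k: "2 / C < \<beta> ^ k" using \<beta> real_arch_pow by blast
  have "expanding_conformal_map \<Lambda> (f ^^ q) (deriv_prod f D q) 2" if "q \<ge> max 1 k" for q
  proof -
    interpret it: conformal_map \<Lambda> "f ^^ q" "deriv_prod f D q" by (rule conformal_map_iterate)
    show ?thesis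
    proof
      fix x assume x: "x \<in> \<Lambda>"
      have "\<beta> ^ k \<le> \<beta> ^ q" using \<beta> that by (intro power_increasing) auto
      with k have "2 / C < \<beta> ^ q" by simp
      then have "2 < C * \<beta> ^ q" using C by (simp add: field_simps)
      with expansion[OF x, of q] show "2 \<le> deriv_prod f D q x" by simp
    qed simp
  qed
  then show ?thesis by (intro exI[of _ "max 1 k"]) simp
qed

text \<open>
  A lower limit is at most the lower limit along the multiples of \<open>q\<close>.
\<close>
lemma growth_rate_nonpos_of_bounded:
  assumes "q \<ge> 1" and B: "\<And>N. fibre_sup \<Lambda> f D s (q * N) \<le> B"
  shows "growth_rate s \<le> 0"
proof (rule ccontr)
  assume "\<not> growth_rate s \<le> 0"
  then have "0 < growth_rate s" by simp
  then obtain c where c: "0 < ereal c" "ereal c < growth_rate s" using ereal_dense2 by blast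
  then have "eventually (\<lambda>n. ereal c < ereal (ln (fibre_sup \<Lambda> f D s n) / n)) sequentially"
    unfolding growth_rate_def by (intro less_LiminfD)
  then obtain n0 where n0: "\<And>n. n \<ge> n0 \<Longrightarrow> c < ln (fibre_sup \<Lambda> f D s n) / n"
    unfolding eventually_sequentially by auto
  obtain N :: nat where N: "N > max (real n0) (ln B / c)" using reals_Archimedean2 by blast
  have "N \<ge> 1" "N \<ge> n0" using N by auto
  have "N \<le> q * N" using assms(1) by simp
  from le_trans[OF \<open>N \<ge> n0\<close> this] have "n0 \<le> q * N" .
  have "c < ln (fibre_sup \<Lambda> f D s (q * N)) / real (q * N)" "real (q * N) > 0"
    using n0[OF \<open>n0 \<le> q * N\<close>] \<open>N \<ge> 1\<close> \<open>N \<le> q * N\<close> by (auto simp del: of_nat_mult)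
  then have "c * real (q * N) < ln (fibre_sup \<Lambda> f D s (q * N))" by (simp add: less_divide_eq del: of_nat_mult)
  also have "\<dots> \<le> ln B" using B fibre_sup_pos by (intro ln_mono) auto
  also have "\<dots> < c * real N" using N c(1) by (simp add: field_simps)
  also have "\<dots> \<le> c * real (q * N)" using c(1) \<open>N \<le> q * N\<close>
    by (intro mult_left_mono) (simp_all only: of_nat_le_iff less_imp_le ereal_less)
  finally show False by simp
qed

lemma hausdorff_null_imp_growth_rate_nonpos:
  assumes t: "0 \<le> t" "t < s" and null: "hausdorff_outer_measure t \<Lambda> = 0"
  shows "growth_rate s \<le> 0"
proof -
  obtain q where q: "q \<ge> 1" and "expanding_conformal_map \<Lambda> (f ^^ q) (deriv_prod f D q) 2"
    using expanding_iterate by blast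
  then interpret it: expanding_conformal_map \<Lambda> "f ^^ q" "deriv_prod f D q" 2 by simp
  obtain B where "\<And>N. fibre_sup \<Lambda> (f ^^ q) (deriv_prod f D q) s N \<le> B"
    using it.fibre_sup_bounded_of_covers[OF t hausdorff_null_ball_covers[OF compact nonempty t(1) null]]
    by blast
  then show ?thesis using growth_rate_nonpos_of_bounded[OF q, of s B] by (simp add: fibre_sup_iterate)
qed

text \<open>
  A negative growth rate puts \<open>fibre_sup\<close> below \<open>1\<close> at some time \<open>n\<close>; by submultiplicativity it stays
  below \<open>1\<close> at the multiples of \<open>n\<close>, and a large multiple is an iterate that expands in one step.
\<close>
lemma growth_rate_neg_imp_upper_box_dim_le:
  assumes t: "0 \<le> t" and neg: "growth_rate t < 0"
  shows "upper_box_dim \<Lambda> \<le> ereal t"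
proof -
  have "\<exists>n\<ge>1. fibre_sup \<Lambda> f D t n < 1"
  proof (rule ccontr)
    assume "\<not> ?thesis"
    then have "0 \<le> ln (fibre_sup \<Lambda> f D t n) / n" if "n \<ge> 1" for n
      using that by (intro divide_nonneg_nonneg ln_ge_zero) (auto simp: not_less)
    then have "eventually (\<lambda>n. 0 \<le> ereal (ln (fibre_sup \<Lambda> f D t n) / n)) sequentially"
      unfolding eventually_sequentially by (intro exI[of _ 1]) auto
    then have "0 \<le> growth_rate t" unfolding growth_rate_def by (rule Liminf_bounded)
    with neg show False by simp
  qed
  then obtain n where n: "n \<ge> 1" "fibre_sup \<Lambda> f D t n < 1" by blast
  obtain k where k: "k \<ge> 1" "\<And>q. q \<ge> k \<Longrightarrow> expanding_conformal_map \<Lambda> (f ^^ q) (deriv_prod f D q) 2"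
    using expanding_iterate by blast
  define q where "q = k * n"
  have "q \<ge> k" using n(1) by (simp add: q_def)
  then interpret it: expanding_conformal_map \<Lambda> "f ^^ q" "deriv_prod f D q" 2 by (rule k(2))
  have "fibre_sup \<Lambda> f D t q \<le> fibre_sup \<Lambda> f D t n ^ k" unfolding q_def by (rule fibre_sup_mult_le_power)
  also have "\<dots> < 1" using n(2) k(1) fibre_sup_pos[of t n] power_strict_decreasing[of 0 k "fibre_sup \<Lambda> f D t n"] by simp
  finally have "fibre_sup \<Lambda> (f ^^ q) (deriv_prod f D q) t 1 < 1" by (simp add: fibre_sup_iterate)
  then obtain E where "E > 0" "\<forall>\<delta>. 0 < \<delta> \<and> \<delta> < 1 \<longrightarrow> (\<exists>k. real k \<le> E * \<delta> powr (- t) \<and> has_cover \<Lambda> \<delta> k)"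
    using it.covering_growth[OF t] by blast
  then show ?thesis by (intro upper_box_dim_le[of E]) auto
qed

end

section \<open>Bowen's formula\<close>

theorem theorem2p1:
  fixes \<Lambda> :: "'a::metric_space set" and f :: "'a \<Rightarrow> 'a"
  assumes "\<Lambda> \<noteq> {}" and "compact \<Lambda>" and "\<forall>x\<in>\<Lambda>. x islimpt \<Lambda>"
    and "continuous_on \<Lambda> f" and "f ` \<Lambda> = \<Lambda>"
    and "C1_conformal_repeller \<Lambda> f"
  shows "\<exists>s :: real. (\<forall>t :: real. pressure t \<Lambda> f = 0 \<longleftrightarrow> t = s) \<and>
           hausdorff_dim \<Lambda> = ereal s \<and>
           lower_box_dim \<Lambda> = ereal s \<and>
           upper_box_dim \<Lambda> = ereal s"
proof -
  let ?D = "conformal_deriv \<Lambda> f"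
  have iter: "conformal_deriv_iter \<Lambda> f = deriv_prod f ?D"
    by (simp add: fun_eq_iff conformal_deriv_iter_def deriv_prod_def)
  obtain C \<beta> where C: "C > 0" "\<beta> > 1" "\<And>x n. x \<in> \<Lambda> \<Longrightarrow> C * \<beta> ^ n \<le> deriv_prod f ?D n x"
    using assms(6) unfolding C1_conformal_repeller_def uniformly_expanding_def iter by blast
  have "C * \<beta> \<le> ?D x" if "x \<in> \<Lambda>" for x
    using C(3)[OF that, of 1] by (simp add: deriv_prod_def)
  then interpret conformal_map \<Lambda> f ?D
    using assms C(1,2) unfolding C1_conformal_repeller_def
    by (intro conformal_map_of_C1[of \<Lambda> f "C * \<beta>"]) auto
  interpret conformal_repeller \<Lambda> f ?D C \<beta>
    by unfold_locales (use C in auto)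
  have P: "pressure t \<Lambda> f = growth_rate t" for t
    unfolding growth_rate_def by (rule pressure_eq) simp
  obtain s where s: "s \<ge> 0" "growth_rate s = 0"
    and less: "\<And>t. t < s \<Longrightarrow> growth_rate t > 0" and greater: "\<And>t. t > s \<Longrightarrow> growth_rate t < 0"
    using growth_rate_zero by metis
  have zero: "pressure t \<Lambda> f = 0 \<longleftrightarrow> t = s" for t
    using s(2) less[of t] greater[of t] unfolding P by (cases t s rule: linorder_cases) auto
  have "ereal s \<le> hausdorff_dim \<Lambda>"
    unfolding hausdorff_dim_def
  proof (rule INF_greatest)
    fix t assume t: "t \<in> {t. 0 \<le> t \<and> hausdorff_outer_measure t \<Lambda> = 0}"
    show "ereal s \<le> ereal t"
    proof (rule ccontr)
      assume "\<not> ereal s \<le> ereal t"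
      then have "t < (t + s) / 2" "(t + s) / 2 < s" by auto
      then have "growth_rate ((t + s) / 2) \<le> 0"
        using t by (intro hausdorff_null_imp_growth_rate_nonpos[of t]) auto
      with less[OF \<open>(t + s) / 2 < s\<close>] show False by simp
    qed
  qed
  moreover have "upper_box_dim \<Lambda> \<le> ereal s"
  proof (rule ccontr)
    assume "\<not> upper_box_dim \<Lambda> \<le> ereal s"
    then have "ereal s < upper_box_dim \<Lambda>" by simp
    then obtain t where t: "ereal s < ereal t" "ereal t < upper_box_dim \<Lambda>" using ereal_dense2 by blast
    then have "upper_box_dim \<Lambda> \<le> ereal t"
      using s(1) greater by (intro growth_rate_neg_imp_upper_box_dim_le) auto
    with t(2) show False by simp
  qed
  moreover note hausdorff_dim_le_lower_box_dim[OF assms(1)] lower_le_upper_box_dim[of \<Lambda>]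
  ultimately have "hausdorff_dim \<Lambda> = ereal s" "lower_box_dim \<Lambda> = ereal s" "upper_box_dim \<Lambda> = ereal s"
    by (meson antisym order_trans)+
  with zero show ?thesis by blast
qed

end
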